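(* For every set $D_0\subset\partial G$ such that $\overline{\mathring D_0}=D_0$ there exists a set $\mathcal T_{D_0}\subset G$ which solves the asymptotic Plateau problem with respect to $D_0$.
   Context: $G$ is a non-elementary word-hyperbolic group with a fixed finite symmetric generating set $S=S^{-1}$; $C(G,S)$ is its Cayley graph with edges of length one and word metric $d$. $\partial G$ is the boundary at infinity (geodesic rays modulo bounded distance), and $G\cup\partial G$ carries the compact topology given by a visual metric; interiors and closures of subsets of $\partial G$ are taken in $\partial G$. For $\mathcal B\subset G$: $\mathcal B^{\mathrm{in}}=\{g\in\mathcal B: gs\in\mathcal B\text{ for all }s\in S\}$, and $\partial^{\mathrm{out}}\mathcal B=\{g\in G\setminus\mathcal B: gs\in\mathcal B\text{ for some }s\in S\}$. Complements $(\cdot)^c$ are in $G$ (or in $\partial G$ for subsets of $\partial G$). For $\mathcal B\subset G$ and finite $\Omega\subset G$, $$b_\Omega(\mathcal B)=\#\{(g,gs)\in\Omega\times\Omega: s\in S,\ g\in\mathcal B,\ gs\notin\mathcal B\}.$$ Let $D_0\subset\partial G$ with $\overline{\mathring D_0}=D_0$ and $D_1:=\overline{(D_0)^c}$. A nonempty set $\mathcal T_{D_0}\subset G$ solves the asymptotic Plateau problem with respect to $D_0$ if there exist $\mathcal D_0,\mathcal D_1\subset G$ with $\mathcal D_0\cap\mathcal D_1=\varnothing$, $\mathcal D_0\cup\mathcal D_1=G$, such that $\mathcal T_{D_0}=\partial^{\mathrm{out}}\mathcal D_0\cup\partial^{\mathrm{out}}\mathcal D_1$ and: (i) every path $p_{\xi,\eta}\subset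 C(G,S)$ connecting a point $\xi\in\mathring D_0$ to a point $\eta\in\mathring D_1$ (a bi-infinite path whose two ends converge to $\xi$ and $\eta$) intersects $\mathcal T_{D_0}$; (ii) for every finite set $\Omega\subset G$ and every set $\tilde{\mathcal B}\subset G$ with $\tilde{\mathcal B}\cap(\Omega^{\mathrm{in}})^c=\mathcal D_0\cap(\Omega^{\mathrm{in}})^c$, one has $b_\Omega(\mathcal D_0)\le b_\Omega(\tilde{\mathcal B})$ and $b_\Omega(\mathcal D_1)\le b_\Omega(\tilde{\mathcal B})$. *)

theory Defs
  imports "HOL-Analysis.Analysis" "HOL-Algebra.Generated_Groups" "HOL-Algebra.Coset"
begin

section \<open>Word metric and word-hyperbolic groups\<close>

definition finite_symmetric_generating_set :: "('a, 'm) monoid_scheme \<Rightarrow> 'a set \<Rightarrow> bool" where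
  "finite_symmetric_generating_set G S \<longleftrightarrow>
     finite S \<and> S \<subseteq> carrier G \<and> (\<lambda>s. inv\<^bsub>G\<^esub> s) ` S = S \<and> generate G S = carrier G"

definition word_length :: "('a, 'm) monoid_scheme \<Rightarrow> 'a set \<Rightarrow> 'a \<Rightarrow> nat" where
  "word_length G S g =
     (LEAST n. \<exists>ws. set ws \<subseteq> S \<and> length ws = n \<and> foldr (\<lambda>s t. s \<otimes>\<^bsub>G\<^esub> t) ws \<one>\<^bsub>G\<^esub> = g)"

text \<open>The Cayley graph has an edge between \<open>g\<close> and \<open>g s\<close> for \<open>s \<in> S\<close>, so its path metric is
  left invariant.\<close>

definition word_dist :: "('a, 'm) monoid_scheme \<Rightarrow> 'a set \<Rightarrow> 'a \<Rightarrow> 'a \<Rightarrow> nat" where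
  "word_dist G S g h = word_length G S (inv\<^bsub>G\<^esub> g \<otimes>\<^bsub>G\<^esub> h)"

definition gromov_product :: "('a, 'm) monoid_scheme \<Rightarrow> 'a set \<Rightarrow> 'a \<Rightarrow> 'a \<Rightarrow> 'a \<Rightarrow> real" where
  "gromov_product G S w x y =
     (real (word_dist G S w x) + real (word_dist G S w y) - real (word_dist G S x y)) / 2"

text \<open>Gromov's definition of hyperbolicity, for the metric space \<open>G\<close> with its word metric.\<close>

definition word_hyperbolic :: "('a, 'm) monoid_scheme \<Rightarrow> 'a set \<Rightarrow> bool" where
  "word_hyperbolic G S \<longleftrightarrow>
     (\<exists>\<delta>. \<forall>w\<in>carrier G. \<forall>x\<in>carrier G. \<forall>y\<in>carrier G. \<forall>z\<in>carrier G.
        gromov_product G S w x z \<ge> min (gromov_product G S w x y) (gromov_product G S w y z) - \<delta>)"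

text \<open>Elementary means finite or virtually infinite cyclic; a finite group is covered by \<open>g = \<one>\<close>.\<close>

definition elementary_group :: "('a, 'm) monoid_scheme \<Rightarrow> bool" where
  "elementary_group G \<longleftrightarrow> (\<exists>g\<in>carrier G. finite (rcosets\<^bsub>G\<^esub> (generate G {g})))"


section \<open>Boundary at infinity and visual metrics\<close>

definition geodesic_rays :: "('a, 'm) monoid_scheme \<Rightarrow> 'a set \<Rightarrow> (nat \<Rightarrow> 'a) set" where
  "geodesic_rays G S =
     {r. (\<forall>n. r n \<in> carrier G) \<and> (\<forall>m n. m \<le> n \<longrightarrow> word_dist G S (r m) (r n) = n - m)}"

definition asymptotic_rel :: "('a, 'm) monoid_scheme \<Rightarrow> 'a set \<Rightarrow> ((nat \<Rightarrow> 'a) \<times> (nat \<Rightarrow> 'a)) set" where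
  "asymptotic_rel G S =
     {(r, r'). r \<in> geodesic_rays G S \<and> r' \<in> geodesic_rays G S \<and>
               (\<exists>C. \<forall>n. word_dist G S (r n) (r' n) \<le> C)}"

definition boundary :: "('a, 'm) monoid_scheme \<Rightarrow> 'a set \<Rightarrow> (nat \<Rightarrow> 'a) set set" where
  "boundary G S = geodesic_rays G S // asymptotic_rel G S"

text \<open>The disjoint union of \<open>G\<close> and its boundary: \<open>Inl\<close> marks group elements, \<open>Inr\<close> boundary points.\<close>

definition compactification ::
    "('a, 'm) monoid_scheme \<Rightarrow> 'a set \<Rightarrow> ('a + (nat \<Rightarrow> 'a) set) set" where
  "compactification G S = carrier G <+> boundary G S"

fun representing_seqs :: "'a + (nat \<Rightarrow> 'a) set \<Rightarrow> (nat \<Rightarrow> 'a) set" where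
  "representing_seqs (Inl g) = {\<lambda>_. g}"
| "representing_seqs (Inr \<xi>) = \<xi>"

definition ext_gromov_product ::
    "('a, 'm) monoid_scheme \<Rightarrow> 'a set \<Rightarrow> 'a + (nat \<Rightarrow> 'a) set \<Rightarrow> 'a + (nat \<Rightarrow> 'a) set \<Rightarrow> ereal" where
  "ext_gromov_product G S x y =
     (SUP (p, q) \<in> representing_seqs x \<times> representing_seqs y.
        Liminf (sequentially \<times>\<^sub>F sequentially)
          (\<lambda>(m, n). ereal (gromov_product G S \<one>\<^bsub>G\<^esub> (p m) (q n))))"

text \<open>The defining estimate is \<open>\<rho> x y \<asymp> a\<close> to the power \<open>- (x | y)\<close>. It can only be asked for distinct
  points, because \<open>(g | g)\<close> is finite for \<open>g \<in> G\<close>. It makes the points of \<open>G\<close> isolated and the points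
  \<open>x\<close> with large \<open>(x | \<xi>)\<close> the neighbourhoods of a boundary point \<open>\<xi>\<close>, so all visual metrics
  induce the same topology.\<close>

definition visual_metric ::
    "('a, 'm) monoid_scheme \<Rightarrow> 'a set \<Rightarrow>
     ('a + (nat \<Rightarrow> 'a) set \<Rightarrow> 'a + (nat \<Rightarrow> 'a) set \<Rightarrow> real) \<Rightarrow> bool" where
  "visual_metric G S \<rho> \<longleftrightarrow>
     Metric_space (compactification G S) \<rho> \<and>
     (\<exists>a>1. \<exists>C\<ge>1. \<forall>x\<in>compactification G S. \<forall>y\<in>compactification G S. x \<noteq> y \<longrightarrow>
        (\<exists>t::real. ext_gromov_product G S x y = ereal t \<and>
           a powr (- t) / C \<le> \<rho> x y \<and> \<rho> x y \<le> C * a powr (- t)))"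

definition compactification_topology ::
    "('a, 'm) monoid_scheme \<Rightarrow> 'a set \<Rightarrow>
     ('a + (nat \<Rightarrow> 'a) set \<Rightarrow> 'a + (nat \<Rightarrow> 'a) set \<Rightarrow> real) \<Rightarrow> ('a + (nat \<Rightarrow> 'a) set) topology" where
  "compactification_topology G S \<rho> = Metric_space.mtopology (compactification G S) \<rho>"

definition boundary_topology ::
    "('a, 'm) monoid_scheme \<Rightarrow> 'a set \<Rightarrow>
     ('a + (nat \<Rightarrow> 'a) set \<Rightarrow> 'a + (nat \<Rightarrow> 'a) set \<Rightarrow> real) \<Rightarrow> (nat \<Rightarrow> 'a) set topology" where
  "boundary_topology G S \<rho> =
     Metric_space.mtopology (boundary G S) (\<lambda>\<xi> \<eta>. \<rho> (Inr \<xi>) (Inr \<eta>))"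


section \<open>The asymptotic Plateau problem\<close>

definition inner_part :: "('a, 'm) monoid_scheme \<Rightarrow> 'a set \<Rightarrow> 'a set \<Rightarrow> 'a set" where
  "inner_part G S B = {g \<in> B. \<forall>s\<in>S. g \<otimes>\<^bsub>G\<^esub> s \<in> B}"

definition outer_boundary :: "('a, 'm) monoid_scheme \<Rightarrow> 'a set \<Rightarrow> 'a set \<Rightarrow> 'a set" where
  "outer_boundary G S B = {g \<in> carrier G - B. \<exists>s\<in>S. g \<otimes>\<^bsub>G\<^esub> s \<in> B}"

definition boundary_size :: "('a, 'm) monoid_scheme \<Rightarrow> 'a set \<Rightarrow> 'a set \<Rightarrow> 'a set \<Rightarrow> nat" where
  "boundary_size G S \<Omega> B =
     card {(g, h). g \<in> \<Omega> \<and> h \<in> \<Omega> \<and> (\<exists>s\<in>S. h = g \<otimes>\<^bsub>G\<^esub> s) \<and> g \<in> B \<and> h \<notin> B}"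

text \<open>Bi-infinite edge paths, given by their successive vertices. A continuous path between two
  boundary points traverses such a sequence of vertices, and only vertices can lie in a subset
  of \<open>G\<close>.\<close>

definition path_between ::
    "('a, 'm) monoid_scheme \<Rightarrow> 'a set \<Rightarrow>
     ('a + (nat \<Rightarrow> 'a) set \<Rightarrow> 'a + (nat \<Rightarrow> 'a) set \<Rightarrow> real) \<Rightarrow>
     (nat \<Rightarrow> 'a) set \<Rightarrow> (nat \<Rightarrow> 'a) set \<Rightarrow> (int \<Rightarrow> 'a) \<Rightarrow> bool" where
  "path_between G S \<rho> \<xi> \<eta> p \<longleftrightarrow>
     (\<forall>i. p i \<in> carrier G) \<and> (\<forall>i. \<exists>s\<in>S. p (i + 1) = p i \<otimes>\<^bsub>G\<^esub> s) \<and>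
     limitin (compactification_topology G S \<rho>) (\<lambda>n. Inl (p (- int n))) (Inr \<xi>) sequentially \<and>
     limitin (compactification_topology G S \<rho>) (\<lambda>n. Inl (p (int n))) (Inr \<eta>) sequentially"

definition solves_asymptotic_plateau ::
    "('a, 'm) monoid_scheme \<Rightarrow> 'a set \<Rightarrow>
     ('a + (nat \<Rightarrow> 'a) set \<Rightarrow> 'a + (nat \<Rightarrow> 'a) set \<Rightarrow> real) \<Rightarrow>
     (nat \<Rightarrow> 'a) set set \<Rightarrow> 'a set \<Rightarrow> bool" where
  "solves_asymptotic_plateau G S \<rho> D\<^sub>0 T \<longleftrightarrow>
     (let X = boundary_topology G S \<rho>; D\<^sub>1 = X closure_of (boundary G S - D\<^sub>0) in
      T \<noteq> {} \<and> T \<subseteq> carrier G \<and>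
      (\<exists>\<D>\<^sub>0 \<D>\<^sub>1. \<D>\<^sub>0 \<inter> \<D>\<^sub>1 = {} \<and> \<D>\<^sub>0 \<union> \<D>\<^sub>1 = carrier G \<and>
         T = outer_boundary G S \<D>\<^sub>0 \<union> outer_boundary G S \<D>\<^sub>1 \<and>
         (\<forall>\<xi> \<eta> p. \<xi> \<in> X interior_of D\<^sub>0 \<longrightarrow> \<eta> \<in> X interior_of D\<^sub>1 \<longrightarrow>
            path_between G S \<rho> \<xi> \<eta> p \<longrightarrow> range p \<inter> T \<noteq> {}) \<and>
         (\<forall>\<Omega> B. finite \<Omega> \<longrightarrow> \<Omega> \<subseteq> carrier G \<longrightarrow> B \<subseteq> carrier G \<longrightarrow>
            B \<inter> (carrier G - inner_part G S \<Omega>) = \<D>\<^sub>0 \<inter> (carrier G - inner_part G S \<Omega>) \<longrightarrow>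
            boundary_size G S \<Omega> \<D>\<^sub>0 \<le> boundary_size G S \<Omega> B \<and>
            boundary_size G S \<Omega> \<D>\<^sub>1 \<le> boundary_size G S \<Omega> B)))"

end

theory Submission
  imports Defs "HOL-Complex_Analysis.Great_Picard"
begin

text \<open>Let \<open>u x = \<rho>(x, D\<^sub>1) - \<rho>(x, D\<^sub>0)\<close>. In the ball of radius \<open>n\<close> minimise the edge boundary among the
  sets that agree with \<open>{u > 0}\<close> outside, and let \<open>\<D>\<^sub>0\<close> be a pointwise limit of these minimisers
  \<open>E\<close>; it is again minimal in every finite set. What has to be shown is that no sequence in the
  complement of \<open>\<D>\<^sub>0\<close> converges to an interior point of \<open>D\<^sub>0\<close>, and symmetrically.

  A visual metric satisfies \<open>\<rho>(x, x s) \<le> C q\<close> to the power \<open>|x|\<close> with \<open>q < 1\<close>, so \<open>u\<close> varies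
  exponentially slowly. Put \<open>\<phi> = max 0 u\<close> to a large power \<open>k\<close>. Adding to \<open>E\<close> a level set of \<open>\<phi>\<close> on
  the complement of \<open>E\<close> does not decrease the edge boundary; combined with the linear isoperimetric
  inequality and integrated over the levels, this bounds \<open>\<Sum>\<phi>\<close> over the complement of \<open>E\<close> by the
  sum of the gradients of \<open>\<phi>\<close>. These gradients are small relative to \<open>\<phi>\<close> except where \<open>u x\<close> is of
  order \<open>q\<close> to the power \<open>|x|\<close>, and there they are summable over \<open>G\<close> if \<open>k\<close> is large. The bound is
  independent of \<open>n\<close>, so only finitely many points with \<open>u \<ge> r > 0\<close> are missing from \<open>\<D>\<^sub>0\<close>.

  The isoperimetric inequality comes from the drift of the word length. A non-elementary group has
  three long elements with small mutual Gromov products (two opposite powers of a hyperbolic element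
  and an element far from its powers), hence exponential growth. So most \<open>y\<close> in a large ball neither
  are short nor have a large Gromov product with a given element, and \<open>|x y| - |x|\<close> is positive on
  average.\<close>

section \<open>The word metric\<close>

locale word_metric_group = group G for G (structure) +
  fixes S :: "'a set"
  assumes gen: "finite_symmetric_generating_set G S"
begin

abbreviation len :: "'a \<Rightarrow> nat" where "len \<equiv> word_length G S"
abbreviation dst :: "'a \<Rightarrow> 'a \<Rightarrow> nat" where "dst \<equiv> word_dist G S"
abbreviation word_prod :: "'a list \<Rightarrow> 'a" where "word_prod ws \<equiv> foldr (\<otimes>) ws \<one>"
definition len_ball :: "nat \<Rightarrow> 'a set" where "len_ball n = {g \<in> carrier G. len g \<le> n}"
definition adjacent :: "'a \<Rightarrow> 'a \<Rightarrow> bool" where "adjacent g h \<longleftrightarrow> (\<exists>s\<in>S. h = g \<otimes> s)"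

lemma finite_S: "finite S" and S_subset: "S \<subseteq> carrier G"
  and inv_S: "(\<lambda>s. inv s) ` S = S" and generate_S: "generate G S = carrier G"
  using gen by (auto simp: finite_symmetric_generating_set_def)

lemma S_carrier [simp]: "s \<in> S \<Longrightarrow> s \<in> carrier G"
  using S_subset by auto

lemma inv_in_S: "s \<in> S \<Longrightarrow> inv s \<in> S"
  using inv_S by auto

lemma word_prod_closed [simp]: "set ws \<subseteq> S \<Longrightarrow> word_prod ws \<in> carrier G"
  by (induction ws) auto

lemma word_prod_append:
  "set ws \<subseteq> S \<Longrightarrow> set vs \<subseteq> S \<Longrightarrow> word_prod (ws @ vs) = word_prod ws \<otimes> word_prod vs"
  by (induction ws) (auto simp: m_assoc)

lemma word_exists:
  assumes "g \<in> carrier G"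
  shows "\<exists>ws. set ws \<subseteq> S \<and> word_prod ws = g"
proof -
  have "g \<in> generate G S" using assms generate_S by simp
  then show ?thesis
  proof (induction rule: generate.induct)
    case one
    show ?case by (rule exI[of _ "[]"]) simp
  next
    case (incl h)
    then show ?case by (intro exI[of _ "[h]"]) auto
  next
    case (inv h)
    then show ?case using inv_in_S by (intro exI[of _ "[inv h]"]) auto
  next
    case (eng h1 h2)
    then obtain ws vs where "set ws \<subseteq> S" "word_prod ws = h1" "set vs \<subseteq> S" "word_prod vs = h2"
      by blast
    then show ?case by (intro exI[of _ "ws @ vs"]) (auto simp: word_prod_append simp del: foldr_append)
  qed
qed

section \<open>Word length and its elementary properties\<close>

lemma len_word:
  assumes "g \<in> carrier G"
  shows "\<exists>ws. set ws \<subseteq> S \<and> length ws = len g \<and> word_prod ws = g"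
proof -
  from word_exists[OF assms] obtain ws where "set ws \<subseteq> S" "word_prod ws = g" by blast
  then have "\<exists>n. \<exists>ws. set ws \<subseteq> S \<and> length ws = n \<and> word_prod ws = g" by blast
  from LeastI_ex[OF this] show ?thesis unfolding word_length_def .
qed

lemma len_word_le: "set ws \<subseteq> S \<Longrightarrow> len (word_prod ws) \<le> length ws"
  unfolding word_length_def by (rule Least_le) blast

lemma len_one [simp]: "len \<one> = 0"
  using len_word_le[of "[]"] by simp

lemma len_eq_0: "g \<in> carrier G \<Longrightarrow> len g = 0 \<longleftrightarrow> g = \<one>"
  using len_word[of g] by auto

lemma len_mult: assumes "g \<in> carrier G" "h \<in> carrier G" shows "len (g \<otimes> h) \<le> len g + len h"
proof -
  obtain ws vs where "set ws \<subseteq> S" "length ws = len g" "word_prod ws = g"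
    "set vs \<subseteq> S" "length vs = len h" "word_prod vs = h"
    using len_word assms by metis
  then show ?thesis using len_word_le[of "ws @ vs"] by (simp add: word_prod_append del: foldr_append)
qed

lemma len_S: "s \<in> S \<Longrightarrow> len s \<le> 1"
  using len_word_le[of "[s]"] by simp

lemma len_inv_le: assumes "g \<in> carrier G" shows "len (inv g) \<le> len g"
proof -
  have "set ws \<subseteq> S \<Longrightarrow> len (inv (word_prod ws)) \<le> length ws" for ws
  proof (induction ws)
    case (Cons s ws)
    then have "len (inv (word_prod ws) \<otimes> inv s) \<le> len (inv (word_prod ws)) + len (inv s)"
      by (intro len_mult) auto
    moreover have "len (inv s) \<le> 1" using Cons inv_in_S len_S by auto
    ultimately show ?case using Cons by (simp add: inv_mult_group)
  qed simp
  then show ?thesis using len_word[OF assms] by metis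
qed

lemma len_inv [simp]: "g \<in> carrier G \<Longrightarrow> len (inv g) = len g"
  using len_inv_le[of g] len_inv_le[of "inv g"] by simp

text \<open>Cut a shortest word for \<open>g\<close> after \<open>k\<close> letters. Both pieces are
  again shortest, since a shorter piece would shorten the word for \<open>g\<close>.\<close>

lemma len_split:
  assumes "g \<in> carrier G" "k \<le> len g"
  shows "\<exists>u v. u \<in> carrier G \<and> v \<in> carrier G \<and> g = u \<otimes> v \<and> len u = k \<and> len v = len g - k"
proof -
  obtain ws where ws: "set ws \<subseteq> S" "length ws = len g" "word_prod ws = g"
    using len_word assms by metis
  define u v where "u = word_prod (take k ws)" and "v = word_prod (drop k ws)"
  have sub: "set (take k ws) \<subseteq> S" "set (drop k ws) \<subseteq> S"
    using ws set_take_subset set_drop_subset by fast+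
  have g: "g = u \<otimes> v"
    using word_prod_append[OF sub] ws(3) unfolding u_def v_def append_take_drop_id by metis
  have "len u \<le> k" "len v \<le> len g - k"
    using len_word_le[OF sub(1)] len_word_le[OF sub(2)] ws by (auto simp: u_def v_def)
  moreover have uv: "u \<in> carrier G" "v \<in> carrier G" using sub by (auto simp: u_def v_def)
  moreover have "len g \<le> len u + len v" using len_mult uv g by simp
  ultimately show ?thesis using g assms(2) by (intro exI[of _ u] exI[of _ v]) auto
qed

lemma len_ball_subset: "len_ball n \<subseteq> carrier G"
  by (auto simp: len_ball_def)

text \<open>Every element of length \<open>n\<close> is the product of a word with \<open>n\<close>
  letters. This crude count later decides how large the exponent of \<open>max 0 u\<close> has to
  be.\<close>

lemma finite_len_sphere: "finite {g \<in> carrier G. len g = n}"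
  and card_len_sphere: "card {g \<in> carrier G. len g = n} \<le> card S ^ n"
proof -
  let ?W = "{ws. set ws \<subseteq> S \<and> length ws = n}"
  have fin: "finite ?W" using finite_lists_length_eq[OF finite_S] .
  have sub: "{g \<in> carrier G. len g = n} \<subseteq> word_prod ` ?W"
    using len_word by (force simp: image_iff)
  show "finite {g \<in> carrier G. len g = n}" using finite_subset[OF sub] fin by blast
  have "card {g \<in> carrier G. len g = n} \<le> card (word_prod ` ?W)"
    using sub fin by (intro card_mono) auto
  also have "\<dots> \<le> card ?W" using fin by (rule card_image_le)
  also have "\<dots> = card S ^ n" by (rule card_lists_length_eq[OF finite_S])
  finally show "card {g \<in> carrier G. len g = n} \<le> card S ^ n" .
qed

lemma finite_len_ball [simp]: "finite (len_ball n)"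
proof -
  have "len_ball n = (\<Union>k\<le>n. {g \<in> carrier G. len g = k})" by (auto simp: len_ball_def)
  then show ?thesis using finite_len_sphere by simp
qed

section \<open>The left-invariant distance and the edges of the Cayley graph\<close>

lemma inv_mult_cancel: "x \<in> carrier G \<Longrightarrow> y \<in> carrier G \<Longrightarrow> inv x \<otimes> (x \<otimes> y) = y"
  by (simp add: m_assoc[symmetric])

lemma mult_inv_cancel: "x \<in> carrier G \<Longrightarrow> y \<in> carrier G \<Longrightarrow> x \<otimes> (inv x \<otimes> y) = y"
  by (simp add: m_assoc[symmetric])

lemma dst_one [simp]: "x \<in> carrier G \<Longrightarrow> dst \<one> x = len x"
  by (simp add: word_dist_def)

lemma dst_self [simp]: "x \<in> carrier G \<Longrightarrow> dst x x = 0"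
  by (simp add: word_dist_def)

lemma dst_commute: assumes "x \<in> carrier G" "y \<in> carrier G" shows "dst x y = dst y x"
  using len_inv[of "inv x \<otimes> y"] assms by (simp add: word_dist_def inv_mult_group)

lemma dst_triangle:
  assumes "x \<in> carrier G" "y \<in> carrier G" "z \<in> carrier G"
  shows "dst x z \<le> dst x y + dst y z"
  using len_mult[of "inv x \<otimes> y" "inv y \<otimes> z"] assms
  by (simp add: word_dist_def m_assoc mult_inv_cancel)

lemma dst_left_mult [simp]:
  "g \<in> carrier G \<Longrightarrow> x \<in> carrier G \<Longrightarrow> y \<in> carrier G \<Longrightarrow> dst (g \<otimes> x) (g \<otimes> y) = dst x y"
  by (simp add: word_dist_def inv_mult_group m_assoc inv_mult_cancel)

lemma dst_mult_right [simp]: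
  "x \<in> carrier G \<Longrightarrow> y \<in> carrier G \<Longrightarrow> dst x (x \<otimes> y) = len y"
  by (simp add: word_dist_def inv_mult_cancel)

lemma adjacent_sym:
  assumes "g \<in> carrier G" "adjacent g h" shows "adjacent h g"
proof -
  obtain s where "s \<in> S" "h = g \<otimes> s" using assms by (auto simp: adjacent_def)
  then show ?thesis using assms inv_in_S
    by (auto simp: adjacent_def m_assoc intro!: bexI[of _ "inv s"])
qed

lemma adjacent_closed: "g \<in> carrier G \<Longrightarrow> adjacent g h \<Longrightarrow> h \<in> carrier G"
  by (auto simp: adjacent_def)

lemma adjacent_set: "{h. adjacent g h} = (\<lambda>s. g \<otimes> s) ` S"
  by (auto simp: adjacent_def)

lemma finite_adjacent [simp]: "finite {h. adjacent g h}"
  using finite_S by (simp add: adjacent_set)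

lemma card_adjacent: "card {h. adjacent g h} \<le> card S"
  using finite_S card_image_le by (metis adjacent_set)

lemma adjacent_dst: "g \<in> carrier G \<Longrightarrow> adjacent g h \<Longrightarrow> dst g h \<le> 1"
  using len_S by (auto simp: adjacent_def)

text \<open>Walking from \<open>x\<close> along a shortest word for \<open>y\<close>, some step must
  leave \<open>F\<close>. The bound on \<open>dst x p\<close> serves to confine points with a
  translate outside \<open>F\<close> to the vicinity of cut edges.\<close>

lemma exit_edge:
  assumes "x \<in> F" "F \<subseteq> carrier G" "y \<in> carrier G" "x \<otimes> y \<notin> F"
  shows "\<exists>p q. p \<in> F \<and> q \<notin> F \<and> adjacent p q \<and> dst x p \<le> len y"
  using assms
proof (induction "len y" arbitrary: y)
  case 0
  then show ?case using len_eq_0 by auto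
next
  case (Suc n)
  obtain u v where uv: "u \<in> carrier G" "v \<in> carrier G" "y = u \<otimes> v" "len u = n" "len v = 1"
    using len_split[of y n] Suc.prems(3) Suc.hyps(2)[symmetric] by auto
  have x: "x \<in> carrier G" using Suc.prems by auto
  show ?case
  proof (cases "x \<otimes> u \<in> F")
    case True
    obtain ws where "set ws \<subseteq> S" "length ws = 1" "word_prod ws = v"
      using len_word[OF uv(2)] uv(5) by metis
    then have "v \<in> S" by (cases ws) auto
    then have "adjacent (x \<otimes> u) (x \<otimes> y)" using uv x by (auto simp: adjacent_def m_assoc)
    then show ?thesis using True Suc.prems(4) Suc.hyps(2) uv(1,4) x
      by (intro exI[of _ "x \<otimes> u"] exI[of _ "x \<otimes> y"]) simp
  next
    case False
    then obtain p q where "p \<in> F \<and> q \<notin> F \<and> adjacent p q \<and> dst x p \<le> len u"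
      using Suc.hyps(1)[of u] uv(1,4) Suc.prems(1,2) by blast
    then show ?thesis using uv(4) Suc.hyps(2) by (intro exI[of _ p] exI[of _ q]) simp
  qed
qed

end

section \<open>Growth and the linear isoperimetric inequality\<close>

lemma sum_indicator_subset:
  "finite A \<Longrightarrow> B \<subseteq> A \<Longrightarrow> (\<Sum>x\<in>A. indicator B x :: real) = real (card B)"
  by (simp add: indicator_def sum.If_cases Int_absorb1)

locale hyperbolic_word_group = word_metric_group +
  fixes \<delta> :: real
  assumes delta_nonneg: "0 \<le> \<delta>"
    and hyperbolic: "\<lbrakk>w \<in> carrier G; x \<in> carrier G; y \<in> carrier G; z \<in> carrier G\<rbrakk> \<Longrightarrow>
      min (gromov_product G S w x y) (gromov_product G S w y z) - \<delta> \<le> gromov_product G S w x z"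
begin

section \<open>Gromov products and branching\<close>

abbreviation gp :: "'a \<Rightarrow> 'a \<Rightarrow> 'a \<Rightarrow> real" where "gp \<equiv> gromov_product G S"

lemma gp_commute: "x \<in> carrier G \<Longrightarrow> y \<in> carrier G \<Longrightarrow> gp w x y = gp w y x"
  by (simp add: gromov_product_def dst_commute[of x y])

lemma gp_nonneg:
  "w \<in> carrier G \<Longrightarrow> x \<in> carrier G \<Longrightarrow> y \<in> carrier G \<Longrightarrow> 0 \<le> gp w x y"
  using dst_triangle[of x w y] dst_commute[of x w] by (simp add: gromov_product_def)

lemma gp_le1:
  "w \<in> carrier G \<Longrightarrow> x \<in> carrier G \<Longrightarrow> y \<in> carrier G \<Longrightarrow> gp w x y \<le> dst w x"
  using dst_triangle[of w x y] by (simp add: gromov_product_def)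

lemma gp_le2:
  "w \<in> carrier G \<Longrightarrow> x \<in> carrier G \<Longrightarrow> y \<in> carrier G \<Longrightarrow> gp w x y \<le> dst w y"
  using gp_le1[of w y x] gp_commute[of x y w] by simp

text \<open>In a tree, the projection of \<open>y\<close> divides the segment from \<open>w\<close>
  to \<open>x\<close> into pieces of these two lengths. A small product at one end thus means a
  large one at the other.\<close>

lemma gp_swap:
  "w \<in> carrier G \<Longrightarrow> x \<in> carrier G \<Longrightarrow> y \<in> carrier G \<Longrightarrow> gp w x y + gp x w y = dst w x"
  using dst_commute[of x w] by (simp add: gromov_product_def field_simps)

lemma gp_self: "w \<in> carrier G \<Longrightarrow> x \<in> carrier G \<Longrightarrow> gp w x x = dst w x"
  by (simp add: gromov_product_def)

lemma gp_left_mult: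
  "g \<in> carrier G \<Longrightarrow> w \<in> carrier G \<Longrightarrow> x \<in> carrier G \<Longrightarrow> y \<in> carrier G \<Longrightarrow>
   gp (g \<otimes> w) (g \<otimes> x) (g \<otimes> y) = gp w x y"
  by (simp add: gromov_product_def)

lemma gp_base_change:
  assumes "x \<in> carrier G" "a \<in> carrier G" "b \<in> carrier G"
  shows "gp x (x \<otimes> a) (x \<otimes> b) = gp \<one> a b"
  using gp_left_mult[of x \<one> a b] assms by simp

lemma gp_base_one:
  assumes "x \<in> carrier G" "b \<in> carrier G"
  shows "gp x \<one> (x \<otimes> b) = gp \<one> (inv x) b"
  using gp_base_change[of x "inv x" b] assms by simp

lemma dst_gp:
  "x \<in> carrier G \<Longrightarrow> y \<in> carrier G \<Longrightarrow> real (dst x y) = len x + len y - 2 * gp \<one> x y"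
  by (simp add: gromov_product_def field_simps)

text \<open>\<open>gp \<one> (inv x) y\<close> measures the cancellation between the two factors;
  what cancels is lost from both of them.\<close>

lemma len_mult_gp:
  assumes "x \<in> carrier G" "y \<in> carrier G"
  shows "real (len (x \<otimes> y)) = len x + len y - 2 * gp \<one> (inv x) y"
  using dst_gp[of "inv x" y] assms by (simp add: word_dist_def)

text \<open>At most one element of \<open>Y\<close> leads from \<open>x\<close> back towards \<open>\<one>\<close>; two others continue outwards, and
  the bound on \<open>gp x \<one> t\<close> keeps the two subtrees disjoint.\<close>

lemma branching:
  assumes Y: "finite Y" "Y \<subseteq> carrier G" "3 \<le> card Y"
    and long: "\<And>y. y \<in> Y \<Longrightarrow> M \<le> real (len y)" and short: "\<And>y. y \<in> Y \<Longrightarrow> len y \<le> P"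
    and sep: "\<And>y z. y \<in> Y \<Longrightarrow> z \<in> Y \<Longrightarrow> y \<noteq> z \<Longrightarrow> gp \<one> y z \<le> c"
    and c: "0 \<le> c" and M: "2 * c + 5 * \<delta> < M" and x: "x \<in> carrier G"
  shows "\<exists>T \<subseteq> carrier G. finite T \<and> card T = 2 ^ n \<and>
           (\<forall>t\<in>T. gp x \<one> t \<le> c + 2 * \<delta> \<and> dst x t \<le> n * P)"
  using x
proof (induction n arbitrary: x)
  case 0
  then show ?case using c delta_nonneg
    by (intro exI[of _ "{x}"]) (auto simp: gromov_product_def dst_commute[of x \<one>])
next
  case (Suc n)
  note x = \<open>x \<in> carrier G\<close>
  define bad where "bad = {y \<in> Y. c + \<delta> < gp \<one> (inv x) y}"
  \<comment> \<open>By hyperbolicity, two different bad elements would have a product above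
    \<open>c\<close>, against \<open>sep\<close>.\<close>
  have "y = z" if "y \<in> bad" "z \<in> bad" for y z
  proof -
    have "y \<in> Y" "z \<in> Y" "y \<in> carrier G" "z \<in> carrier G" using that Y by (auto simp: bad_def)
    then show ?thesis
      using hyperbolic[of \<one> y "inv x" z] sep[of y z] that x gp_commute[of "inv x" y \<one>]
      by (auto simp: bad_def min_def split: if_splits)
  qed
  then have "card bad \<le> 1"
    using Y(1) card_le_Suc0_iff_eq[of bad] by (simp add: bad_def)
  moreover have "card (Y - bad) = card Y - card bad"
    using Y by (intro card_Diff_subset) (auto simp: bad_def intro: finite_subset)
  ultimately have "2 \<le> card (Y - bad)" using Y by linarith
  then obtain a b where ab: "a \<in> Y - bad" "b \<in> Y - bad" "a \<noteq> b"
    by (metis card_le_Suc0_iff_eq finite_Diff Y(1) not_less_eq_eq numeral_2_eq_2)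
  have good: "\<exists>T \<subseteq> carrier G. finite T \<and> card T = 2 ^ n \<and>
      (\<forall>t\<in>T. gp x \<one> t \<le> c + 2 * \<delta> \<and> dst x t \<le> Suc n * P \<and>
             M - c - 3 * \<delta> \<le> gp x (x \<otimes> y) t)"
    if y: "y \<in> Y - bad" for y
  proof -
    have yc: "y \<in> carrier G" using y Y by auto
    define z where "z = x \<otimes> y"
    have z: "z \<in> carrier G" using x yc by (simp add: z_def)
    obtain T where T: "T \<subseteq> carrier G" "finite T" "card T = 2 ^ n"
      "\<And>t. t \<in> T \<Longrightarrow> gp z \<one> t \<le> c + 2 * \<delta>" "\<And>t. t \<in> T \<Longrightarrow> dst z t \<le> n * P"
      using Suc.IH[OF z] by blast
    have xz: "real (dst x z) \<ge> M" "dst x z \<le> P" using long short y x yc by (auto simp: z_def)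
    have oz: "gp x \<one> z \<le> c + \<delta>"
      using y x yc by (auto simp: bad_def z_def gp_base_one)
    show ?thesis
    proof (intro exI[of _ T] conjI ballI T)
      fix t assume t: "t \<in> T"
      then have tc: "t \<in> carrier G" using T by auto
      \<comment> \<open>Seen from \<open>z\<close>, the identity lies in the direction of
        \<open>x\<close>. Hence \<open>t\<close>, which avoids the direction of the identity, avoids
        that of \<open>x\<close> as well.\<close>
      have "gp z \<one> x \<ge> M - c - \<delta>"
        using gp_swap[of x z \<one>] gp_commute[of \<one> z x] gp_commute[of \<one> x z] oz xz x z by simp
      then have xt: "gp z x t \<le> c + 3 * \<delta>"
        using hyperbolic[of z \<one> x t] T(4)[OF t] M x z tc delta_nonneg by (auto simp: min_def split: if_splits)
      show zt: "M - c - 3 * \<delta> \<le> gp x (x \<otimes> y) t"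
        using gp_swap[of x z t] xz x z tc xt by (simp add: z_def)
      then show "gp x \<one> t \<le> c + 2 * \<delta>"
        using hyperbolic[of x \<one> t z] oz M x z tc gp_commute[of t z x]
        by (auto simp: min_def z_def split: if_splits)
      show "dst x t \<le> Suc n * P"
        using dst_triangle[of x z t] xz T(5)[OF t] x z tc by auto
    qed
  qed
  obtain T where T: "T \<subseteq> carrier G" "finite T" "card T = 2 ^ n"
      "\<And>t. t \<in> T \<Longrightarrow> gp x \<one> t \<le> c + 2 * \<delta> \<and> dst x t \<le> Suc n * P \<and>
             M - c - 3 * \<delta> \<le> gp x (x \<otimes> a) t"
    using good[OF ab(1)] by blast
  obtain U where U: "U \<subseteq> carrier G" "finite U" "card U = 2 ^ n"
      "\<And>t. t \<in> U \<Longrightarrow> gp x \<one> t \<le> c + 2 * \<delta> \<and> dst x t \<le> Suc n * P \<and>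
             M - c - 3 * \<delta> \<le> gp x (x \<otimes> b) t"
    using good[OF ab(2)] by blast
  \<comment> \<open>A common point would have large products at \<open>x\<close> with both
    \<open>x \<otimes> a\<close> and \<open>x \<otimes> b\<close>, and by hyperbolicity and the size
    of \<open>M\<close> these two would have a product above \<open>c\<close>.\<close>
  have "T \<inter> U = {}"
  proof (rule ccontr)
    assume "T \<inter> U \<noteq> {}"
    then obtain t where t: "t \<in> T" "t \<in> U" by auto
    have cs: "a \<in> carrier G" "b \<in> carrier G" "t \<in> carrier G" using ab Y T t by auto
    have "gp x (x \<otimes> a) (x \<otimes> b) \<le> c" using sep[of a b] ab x cs by (simp add: gp_base_change)
    then show False
      using hyperbolic[of x "x \<otimes> a" t "x \<otimes> b"] T(4)[OF t(1)] U(4)[OF t(2)] M x cs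
        gp_commute[of t "x \<otimes> b" x] delta_nonneg by (auto simp: min_def split: if_splits)
  qed
  then have "card (T \<union> U) = 2 ^ Suc n" using T U by (simp add: card_Un_disjoint)
  then show ?case using T U by (intro exI[of _ "T \<union> U"]) auto
qed

lemma len_ball_growth:
  assumes Y: "finite Y" "Y \<subseteq> carrier G" "3 \<le> card Y"
    and long: "\<And>y. y \<in> Y \<Longrightarrow> M \<le> real (len y)" and short: "\<And>y. y \<in> Y \<Longrightarrow> len y \<le> P"
    and sep: "\<And>y z. y \<in> Y \<Longrightarrow> z \<in> Y \<Longrightarrow> y \<noteq> z \<Longrightarrow> gp \<one> y z \<le> c"
    and c: "0 \<le> c" and M: "2 * c + 5 * \<delta> < M"
  shows "2 ^ n \<le> card (len_ball (n * P))"
proof -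
  obtain T where T: "T \<subseteq> carrier G" "card T = 2 ^ n" "\<forall>t\<in>T. dst \<one> t \<le> n * P"
    using branching[OF assms one_closed, of n] by blast
  then have "T \<subseteq> len_ball (n * P)" by (auto simp: len_ball_def subset_iff)
  then show ?thesis using card_mono[OF finite_len_ball] T(2) by metis
qed

end

section \<open>From exponential growth to positive drift\<close>

lemma (in word_metric_group) len_ball_mono: "m \<le> n \<Longrightarrow> len_ball m \<subseteq> len_ball n"
  by (auto simp: len_ball_def)

text \<open>With \<open>K = 4 * P\<close>, growth yields at least \<open>16 ^ j\<close> elements at
  radius \<open>j * K\<close>. If the ball grew by a factor below 8 over every window of length
  \<open>K\<close> from some radius on, its size would be at most a constant times
  \<open>8 ^ j\<close>.\<close>

lemma (in word_metric_group) len_ball_drop: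
  assumes growth: "\<And>n. 2 ^ n \<le> card (len_ball (n * P))"
  shows "\<exists>K. \<forall>L0. \<exists>L\<ge>L0. K \<le> L \<and> 8 * card (len_ball (L - K)) \<le> card (len_ball L)"
proof (rule ccontr)
  define K where "K = 4 * P"
  assume "\<not> ?thesis"
  then obtain L1 where L1: "\<And>L. L1 \<le> L \<Longrightarrow> K \<le> L \<Longrightarrow> card (len_ball L) < 8 * card (len_ball (L - K))"
    by (metis not_le)
  define L0 where "L0 = L1 + K"
  have up: "card (len_ball (L0 + j * K)) \<le> 8 ^ j * card (len_ball L0)" for j
  proof (induction j)
    case (Suc j)
    have "card (len_ball (L0 + Suc j * K)) < 8 * card (len_ball (L0 + Suc j * K - K))"
      by (intro L1) (auto simp: L0_def)
    also have "L0 + Suc j * K - K = L0 + j * K" by simp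
    finally show ?case using Suc by simp
  qed simp
  have "2 ^ j \<le> card (len_ball L0)" for j
  proof -
    have "(2::nat) ^ (4 * j) \<le> card (len_ball (4 * j * P))" by (rule growth)
    also have "\<dots> \<le> card (len_ball (L0 + j * K))"
      by (intro card_mono finite_len_ball len_ball_mono) (simp add: K_def)
    also have "\<dots> \<le> 8 ^ j * card (len_ball L0)" by (rule up)
    finally have "(8::nat) ^ j * 2 ^ j \<le> 8 ^ j * card (len_ball L0)"
      by (simp add: power_mult flip: power_mult_distrib)
    then show ?thesis by simp
  qed
  then show False using less_exp not_le by blast
qed

context hyperbolic_word_group
begin

text \<open>If \<open>s\<close> exceeds \<open>L\<close> or \<open>len z\<close>, the cone is empty.
  Otherwise its elements nearly pass through the initial piece \<open>u\<close> of \<open>z\<close>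
  of length \<open>s\<close>, and translation by \<open>inv u\<close> moves them into a ball whose
  radius is smaller by \<open>s - D\<close>.\<close>

lemma card_cone:
  assumes z: "z \<in> carrier G" and D: "2 * \<delta> \<le> real D"
  shows "card {y \<in> len_ball L. real s \<le> gp \<one> z y} \<le> card (len_ball (L + D - s))"
proof (cases "\<exists>y. y \<in> len_ball L \<and> real s \<le> gp \<one> z y")
  case True
  then obtain y0 where "y0 \<in> len_ball L" "real s \<le> gp \<one> z y0" by blast
  then have "s \<le> len z" "s \<le> L" using gp_le1[of \<one> z y0] gp_le2[of \<one> z y0] z
    by (auto simp: len_ball_def)
  then obtain u v where uv: "u \<in> carrier G" "v \<in> carrier G" "z = u \<otimes> v" "len u = s"
    "len v = len z - s" using len_split[OF z] by blast
  have uz: "gp \<one> u z = s" using uv z \<open>s \<le> len z\<close> by (simp add: gromov_product_def)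
  have "{y \<in> len_ball L. real s \<le> gp \<one> z y} \<subseteq> (\<lambda>w. u \<otimes> w) ` len_ball (L + D - s)"
  proof
    fix y assume "y \<in> {y \<in> len_ball L. real s \<le> gp \<one> z y}"
    then have y: "y \<in> carrier G" "len y \<le> L" "real s \<le> gp \<one> z y" by (auto simp: len_ball_def)
    have "gp \<one> u y \<ge> s - \<delta>" using hyperbolic[of \<one> u z y] uz y uv z by auto
    then have "real (dst u y) \<le> real (L + D - s)"
      using dst_gp[of u y] uv y D \<open>s \<le> L\<close> by (simp add: of_nat_diff)
    then show "y \<in> (\<lambda>w. u \<otimes> w) ` len_ball (L + D - s)"
      using uv y by (intro image_eqI[of _ _ "inv u \<otimes> y"])
        (auto simp: len_ball_def word_dist_def mult_inv_cancel)
  qed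
  then show ?thesis using surj_card_le finite_len_ball by blast
next
  case False
  then have "{y \<in> len_ball L. real s \<le> gp \<one> z y} = {}" by auto
  then show ?thesis by (simp only: card.empty)
qed

text \<open>Short \<open>y\<close>, and \<open>y\<close> that cancel much against \<open>x\<close>,
  each fill at most an eighth of the ball. Every other \<open>y\<close> lengthens \<open>x\<close>
  by at least \<open>L - K - 2 * s\<close>. The radius \<open>L\<close> does not depend on
  \<open>x\<close>.\<close>

lemma drift:
  assumes growth: "\<And>n. 2 ^ n \<le> card (len_ball (n * P))"
  shows "\<exists>L. \<forall>x\<in>carrier G. 1 \<le> (\<Sum>y\<in>len_ball L. real (len (x \<otimes> y)) - real (len x))"
proof -
  obtain K where K: "\<And>L0. \<exists>L\<ge>L0. K \<le> L \<and> 8 * card (len_ball (L - K)) \<le> card (len_ball L)"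
    using len_ball_drop[OF growth] by blast
  obtain D where D: "2 * \<delta> \<le> real D" using real_arch_simple by blast
  \<comment> \<open>With this value the radius \<open>L + D - s\<close> in the cone bound becomes
    \<open>L - K\<close>.\<close>
  define s where "s = K + D"
  \<comment> \<open>The lower bound on \<open>L\<close> makes
    \<open>5 L / 8 - 7 K / 8 - 2 s\<close>, the average drift that remains below, at least
    1.\<close>
  obtain L where L: "4 * s + 2 * K + 2 \<le> L" "8 * card (len_ball (L - K)) \<le> card (len_ball L)"
    using K by blast
  define N where "N = real (card (len_ball L))"
  have "\<one> \<in> len_ball L" by (simp add: len_ball_def)
  then have "0 < card (len_ball L)" using finite_len_ball by (auto simp: card_gt_0_iff)
  then have N: "1 \<le> N" by (simp add: N_def)
  show ?thesis
  proof (intro exI[of _ L] ballI)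
    fix x assume x: "x \<in> carrier G"
    define bad where "bad = {y \<in> len_ball L. real s \<le> gp \<one> (inv x) y}"
    have "card bad \<le> card (len_ball (L + D - s))"
      unfolding bad_def using x D by (intro card_cone) auto
    also have "L + D - s = L - K" using L by (simp add: s_def)
    finally have bad: "8 * real (card bad) \<le> N" using L(2) by (simp add: N_def)
    have small: "8 * real (card (len_ball (L - K))) \<le> N" using L(2) by (simp add: N_def)
    \<comment> \<open>A short \<open>y\<close> gives up the gain \<open>L - K\<close>; a bad
      \<open>y\<close> is charged \<open>2 * L\<close>, because the product never exceeds
      \<open>len y\<close>.\<close>
    have lower: "real (L - K) - 2 * s - real (L - K) * indicator (len_ball (L - K)) y
        - 2 * real L * indicator bad y \<le> real (len (x \<otimes> y)) - real (len x)"
      if y: "y \<in> len_ball L" for y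
    proof -
      have yc: "y \<in> carrier G" "len y \<le> L" using y by (auto simp: len_ball_def)
      have eq: "real (len (x \<otimes> y)) - real (len x) = len y - 2 * gp \<one> (inv x) y"
        using len_mult_gp x yc by simp
      have 1: "real (L - K) - real (L - K) * indicator (len_ball (L - K)) y \<le> len y"
        using yc by (auto simp: indicator_def len_ball_def)
      have 2: "gp \<one> (inv x) y \<le> s + real L * indicator bad y"
        using gp_le2[of \<one> "inv x" y] x yc y by (auto simp: indicator_def bad_def)
      show ?thesis using 1 2 eq by (simp add: algebra_simps)
    qed
    have "(\<Sum>y\<in>len_ball L. indicator bad y :: real) = real (card bad)"
      by (intro sum_indicator_subset) (auto simp: bad_def)
    moreover have "(\<Sum>y\<in>len_ball L. indicator (len_ball (L - K)) y :: real) = real (card (len_ball (L - K)))"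
      by (intro sum_indicator_subset len_ball_mono) auto
    ultimately have "(\<Sum>y\<in>len_ball L. real (L - K) - 2 * s - real (L - K) * indicator (len_ball (L - K)) y
        - 2 * real L * indicator bad y) =
       N * (real (L - K) - 2 * s) - real (L - K) * card (len_ball (L - K)) - 2 * real L * card bad"
      by (simp add: sum_subtractf N_def flip: sum_distrib_left)
    moreover have "real (L - K) * card (len_ball (L - K)) \<le> real (L - K) * (N / 8)"
      using small by (intro mult_left_mono) auto
    moreover have "2 * real L * card bad \<le> 2 * real L * (N / 8)"
      using bad by (intro mult_left_mono) auto
    moreover have "1 * 1 \<le> N * (real (L - K) * 7 / 8 - 2 * s - real L / 4)"
      using N L by (intro mult_mono) (auto simp: of_nat_diff field_simps)
    ultimately have "1 \<le> (\<Sum>y\<in>len_ball L. real (L - K) - 2 * s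
        - real (L - K) * indicator (len_ball (L - K)) y - 2 * real L * indicator bad y)"
      by (simp add: algebra_simps)
    also have "\<dots> \<le> (\<Sum>y\<in>len_ball L. real (len (x \<otimes> y)) - real (len x))"
      by (intro sum_mono lower)
    finally show "1 \<le> (\<Sum>y\<in>len_ball L. real (len (x \<otimes> y)) - real (len x))" .
  qed
qed

end

section \<open>From drift to the isoperimetric inequality\<close>

definition (in word_metric_group) cut_edges :: "'a set \<Rightarrow> ('a \<times> 'a) set" where
  "cut_edges F = {(p, q). p \<in> F \<and> q \<notin> F \<and> adjacent p q}"

lemma (in word_metric_group) finite_cut_edges:
  assumes "finite F" shows "finite (cut_edges F)"
proof (rule finite_subset)
  show "cut_edges F \<subseteq> (SIGMA p:F. {q. adjacent p q})" by (auto simp: cut_edges_def)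
  show "finite (SIGMA p:F. {q. adjacent p q})" using assms by auto
qed

text \<open>Within \<open>F\<close> the differences of lengths cancel in pairs, so the total drift is carried by the points
  of \<open>F\<close> near its boundary.\<close>

lemma (in word_metric_group) isoperimetric_of_drift:
  assumes drift: "\<And>x. x \<in> carrier G \<Longrightarrow> 1 \<le> (\<Sum>y\<in>len_ball L. real (len (x \<otimes> y)) - real (len x))"
  shows "\<exists>c>0. \<forall>F. finite F \<longrightarrow> F \<subseteq> carrier G \<longrightarrow> c * real (card F) \<le> real (card (cut_edges F))"
proof -
  define N where "N = real (card (len_ball L))"
  have "real (card F) \<le> (N * N * L) * real (card (cut_edges F))"
    if F: "finite F" "F \<subseteq> carrier G" for F
  proof -
    \<comment> \<open>On \<open>F\<close> this is antisymmetric in \<open>x\<close> and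
      \<open>z\<close>, so its double sum over \<open>F\<close> vanishes.\<close>
    define f where "f x z = (real (len z) - real (len x)) * (if dst x z \<le> L then 1 else 0)" for x z
    define X where "X = {x \<in> F. \<exists>y\<in>len_ball L. x \<otimes> y \<notin> F}"
    have sum_in: "(\<Sum>y\<in>len_ball L. if x \<otimes> y \<in> F then real (len (x \<otimes> y)) - real (len x) else 0)
        = (\<Sum>z\<in>F. f x z)" if x: "x \<in> F" for x
    proof -
      have xc: "x \<in> carrier G" using F x by auto
      have "(\<Sum>y\<in>len_ball L. if x \<otimes> y \<in> F then real (len (x \<otimes> y)) - real (len x) else 0)
          = (\<Sum>y\<in>{y\<in>len_ball L. x \<otimes> y \<in> F}. real (len (x \<otimes> y)) - real (len x))"
        by (simp add: sum.inter_filter)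
      also have "\<dots> = (\<Sum>z\<in>{z\<in>F. dst x z \<le> L}. real (len z) - real (len x))"
        using xc F(2)
        by (intro sum.reindex_bij_witness[of _ "\<lambda>z. inv x \<otimes> z" "\<lambda>y. x \<otimes> y"])
           (auto simp: len_ball_def inv_mult_cancel mult_inv_cancel subset_iff word_dist_def)
      also have "\<dots> = (\<Sum>z\<in>F. f x z)"
        using F by (simp add: sum.inter_filter f_def if_distrib cong: if_cong)
      finally show ?thesis .
    qed
    have "(\<Sum>x\<in>F. \<Sum>z\<in>F. f x z) = (\<Sum>x\<in>F. \<Sum>z\<in>F. f z x)" by (rule sum.swap)
    also have "\<dots> = (\<Sum>x\<in>F. \<Sum>z\<in>F. - f x z)"
      using F by (intro sum.cong) (auto simp: f_def dst_commute subset_iff algebra_simps)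
    finally have zero: "(\<Sum>x\<in>F. \<Sum>z\<in>F. f x z) = 0" by (simp add: sum_negf)
    have "real (card F) = (\<Sum>x\<in>F. 1)" by simp
    also have "\<dots> \<le> (\<Sum>x\<in>F. \<Sum>y\<in>len_ball L. real (len (x \<otimes> y)) - real (len x))"
      using F by (intro sum_mono drift) auto
    also have "\<dots> \<le> (\<Sum>x\<in>F. (\<Sum>z\<in>F. f x z) + N * L * (indicator X x :: real))"
    proof (intro sum_mono)
      fix x assume x: "x \<in> F"
      then have xc: "x \<in> carrier G" using F by auto
      have "(\<Sum>y\<in>len_ball L. real (len (x \<otimes> y)) - real (len x)) \<le>
         (\<Sum>y\<in>len_ball L. (if x \<otimes> y \<in> F then real (len (x \<otimes> y)) - real (len x) else 0)
            + L * (indicator X x :: real))"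
      proof (intro sum_mono)
        fix y assume y: "y \<in> len_ball L"
        then have "len (x \<otimes> y) \<le> len x + L" using len_mult[of x y] xc by (auto simp: len_ball_def)
        then show "real (len (x \<otimes> y)) - real (len x) \<le>
           (if x \<otimes> y \<in> F then real (len (x \<otimes> y)) - real (len x) else 0) + L * (indicator X x :: real)"
          using x y by (cases "x \<in> X") (auto simp: X_def indicator_def)
      qed
      also have "\<dots> = (\<Sum>z\<in>F. f x z) + N * L * (indicator X x :: real)"
        by (simp add: sum.distrib sum_in x N_def)
      finally show "(\<Sum>y\<in>len_ball L. real (len (x \<otimes> y)) - real (len x))
        \<le> (\<Sum>z\<in>F. f x z) + N * L * (indicator X x :: real)" .
    qed
    also have "\<dots> = N * L * real (card X)"
    proof -
      have "(\<Sum>x\<in>F. indicator X x :: real) = real (card X)"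
        using F by (intro sum_indicator_subset) (auto simp: X_def)
      then show ?thesis using zero by (simp add: sum.distrib flip: sum_distrib_left)
    qed
    also have "N * L * real (card X) \<le> N * L * (real (card (cut_edges F)) * N)"
    proof (rule mult_left_mono)
      \<comment> \<open>A point of \<open>X\<close> lies within \<open>L\<close> of the inner end of
        some cut edge, so the edge and a displacement in the ball recover it.\<close>
      let ?h = "\<lambda>(pq, y). fst pq \<otimes> y"
      have "X \<subseteq> ?h ` (cut_edges F \<times> len_ball L)"
      proof
        fix x assume "x \<in> X"
        then obtain y where y: "x \<in> F" "y \<in> carrier G" "len y \<le> L" "x \<otimes> y \<notin> F"
          by (auto simp: X_def len_ball_def)
        obtain p q where pq: "p \<in> F" "q \<notin> F" "adjacent p q" "dst x p \<le> len y"
          using exit_edge[OF y(1) F(2) y(2) y(4)] by blast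
        have c: "x \<in> carrier G" "p \<in> carrier G" using F y pq by auto
        have "x = ?h ((p, q), inv p \<otimes> x)" using c by (simp add: mult_inv_cancel)
        moreover have "((p, q), inv p \<otimes> x) \<in> cut_edges F \<times> len_ball L"
          using c pq y dst_commute[of x p] by (auto simp: cut_edges_def len_ball_def word_dist_def)
        ultimately show "x \<in> ?h ` (cut_edges F \<times> len_ball L)" by blast
      qed
      then have "card X \<le> card (cut_edges F \<times> len_ball L)"
        using finite_cut_edges[OF F(1)] by (intro surj_card_le) auto
      then show "real (card X) \<le> real (card (cut_edges F)) * N"
        by (simp add: N_def card_cartesian_product flip: of_nat_mult)
    qed (simp add: N_def)
    finally show ?thesis by (simp add: mult_ac)
  qed
  note bound = this
  \<comment> \<open>The summand 1 keeps the denominator positive.\<close>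
  define c where "c = 1 / (N * N * L + 1)"
  have pos: "0 \<le> N * N * L" by (simp add: N_def)
  have "c * real (card F) \<le> real (card (cut_edges F))" if F: "finite F" "F \<subseteq> carrier G" for F
    using bound[OF F] pos unfolding c_def
    by (simp add: field_simps add_increasing2)
  moreover have "0 < c" using pos unfolding c_def by (intro divide_pos_pos add_nonneg_pos) auto
  ultimately show ?thesis by blast
qed

section \<open>Hyperbolic elements\<close>

context hyperbolic_word_group
begin

text \<open>The powers of such an element form a quasi-geodesic line.\<close>

definition axial :: "'a \<Rightarrow> bool" where
  "axial g \<longleftrightarrow> g \<in> carrier G \<and> 2 * gp \<one> g (inv g) + 3 * \<delta> < len g"

lemma axial_inv: "axial g \<Longrightarrow> axial (inv g)"
  using gp_commute[of g "inv g" \<one>] by (auto simp: axial_def)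

lemma gp_one_mult:
  assumes "x \<in> carrier G" "y \<in> carrier G"
  shows "gp \<one> x (x \<otimes> y) = len x - gp \<one> (inv x) y"
  using gp_swap[of \<one> x "x \<otimes> y"] gp_base_one[of x y] assms by simp

text \<open>Induction: if little cancels in \<open>g \<otimes> g [^] Suc n\<close>, the product
  starts in the direction of \<open>g\<close>. Since \<open>g\<close> and \<open>inv g\<close> point
  in different directions, it does not start like \<open>inv g\<close>, so the next multiplication
  by \<open>g\<close> cancels little too.\<close>

lemma axial_inv_pow:
  assumes "axial g"
  shows "gp \<one> (inv g) (g [^] Suc n) \<le> gp \<one> g (inv g) + \<delta>"
proof (induction n)
  case 0
  show ?case using assms delta_nonneg gp_commute[of g "inv g" \<one>] by (simp add: axial_def)
next
  case (Suc n)
  have g: "g \<in> carrier G" using assms by (simp add: axial_def)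
  have "g [^] Suc (Suc n) = g \<otimes> g [^] Suc n" using g nat_pow_Suc2 by blast
  then have "gp \<one> g (g [^] Suc (Suc n)) = len g - gp \<one> (inv g) (g [^] Suc n)"
    using gp_one_mult[of g "g [^] Suc n"] g by simp
  then show ?case
    using Suc assms g hyperbolic[of \<one> "inv g" "g [^] Suc (Suc n)" g] delta_nonneg
      gp_commute[of g "inv g" \<one>] gp_commute[of "g [^] Suc (Suc n)" g \<one>]
    by (auto simp: axial_def min_def simp del: nat_pow_Suc split: if_splits)
qed

lemma axial_pow:
  assumes "axial g"
  shows "len g - gp \<one> g (inv g) - \<delta> \<le> gp \<one> g (g [^] Suc n)"
proof (cases n)
  case 0
  then show ?thesis using assms delta_nonneg gp_nonneg[of \<one> g "inv g"]
    by (simp add: axial_def gp_self)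
next
  case (Suc m)
  have g: "g \<in> carrier G" using assms by (simp add: axial_def)
  have "g [^] Suc n = g \<otimes> g [^] Suc m" using g nat_pow_Suc2 Suc by blast
  then show ?thesis
    using gp_one_mult[of g "g [^] Suc m"] g axial_inv_pow[OF assms, of m] by simp
qed

text \<open>Each further factor adds \<open>len g\<close> minus twice a cancellation that
  \<open>axial_inv_pow\<close> bounds.\<close>

lemma axial_len_pow:
  assumes "axial g"
  shows "real n * (len g - 2 * gp \<one> g (inv g) - 2 * \<delta>) \<le> len (g [^] n)"
proof (induction n)
  case (Suc n)
  have g: "g \<in> carrier G" using assms by (simp add: axial_def)
  show ?case
  proof (cases n)
    case 0
    then show ?thesis using g delta_nonneg gp_nonneg[of \<one> g "inv g"] by simp
  next
    case (Suc m)
    have "len (g [^] Suc n) = len g + len (g [^] n) - 2 * gp \<one> (inv g) (g [^] n)"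
      using nat_pow_Suc2[OF g, of n] len_mult_gp[of g "g [^] n"] g by simp
    moreover have "gp \<one> (inv g) (g [^] n) \<le> gp \<one> g (inv g) + \<delta>"
      using axial_inv_pow[OF assms, of m] Suc by simp
    ultimately show ?thesis using Suc.IH by (simp add: algebra_simps)
  qed
qed simp

text \<open>Powers of \<open>inv g\<close> start in the direction of \<open>inv g\<close> and
  positive powers of \<open>g\<close> do not, so hyperbolicity separates them. An exponent 0 gives
  the identity, whose products vanish.\<close>

lemma axial_two_sided:
  assumes "axial g"
  shows "gp \<one> (g [^] (n::nat)) (inv g [^] (k::nat)) \<le> gp \<one> g (inv g) + 2 * \<delta>"
proof -
  have g: "g \<in> carrier G" using assms by (simp add: axial_def)
  have nonneg: "0 \<le> gp \<one> g (inv g)" using g gp_nonneg by simp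
  show ?thesis
  proof (cases "n = 0 \<or> k = 0")
    case True
    then show ?thesis
      using gp_le1[of \<one> \<one> "inv g [^] k"] gp_le2[of \<one> "g [^] n" \<one>] g nonneg delta_nonneg by auto
  next
    case False
    then obtain n' k' where nk: "n = Suc n'" "k = Suc k'" by (metis not0_implies_Suc)
    let ?a = "g [^] n" and ?b = "inv g [^] k"
    have c: "?a \<in> carrier G" "?b \<in> carrier G" using g by auto
    have 1: "gp \<one> (inv g) ?a \<le> gp \<one> g (inv g) + \<delta>"
      using axial_inv_pow[OF assms, of n'] nk by simp
    have 2: "len g - gp \<one> g (inv g) - \<delta> \<le> gp \<one> (inv g) ?b"
      using axial_pow[OF axial_inv[OF assms], of k'] nk g gp_commute[of g "inv g" \<one>] by simp
    show ?thesis
      using 1 2 hyperbolic[of \<one> ?a ?b "inv g"] g c assms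
        gp_commute[of "inv g" ?a \<one>] gp_commute[of "inv g" ?b \<one>]
      by (auto simp: axial_def min_def split: if_splits)
  qed
qed

text \<open>Let \<open>t\<close> be the product and \<open>k\<close> the first exponent with
  \<open>t \<le> len (g [^] k)\<close>. This power lies near the way to \<open>g [^] n\<close>, so
  its product with \<open>y\<close> is almost \<open>t\<close>. As \<open>\<one>\<close> is a
  nearest power to \<open>y\<close>, that product is at most half of
  \<open>len (g [^] k) \<le> t + len g\<close>, which bounds \<open>t\<close>.\<close>

lemma axial_nearest:
  assumes "axial g" and y: "y \<in> carrier G" and near: "\<And>k::nat. len y \<le> dst y (g [^] k)"
  shows "gp \<one> y (g [^] (n::nat)) \<le> len g + 2 * gp \<one> g (inv g) + 6 * \<delta>"
proof -
  have g: "g \<in> carrier G" using assms by (simp add: axial_def)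
  have nonneg: "0 \<le> gp \<one> g (inv g)" using g gp_nonneg by simp
  define t where "t = gp \<one> y (g [^] n)"
  have tn: "t \<le> len (g [^] n)" using gp_le2[of \<one> y "g [^] n"] y g by (simp add: t_def)
  define k where "k = (LEAST k::nat. t \<le> len (g [^] k))"
  have k: "t \<le> len (g [^] k)" "k \<le> n" using LeastI[where P="\<lambda>k::nat. t \<le> len (g [^] k)", OF tn]
    Least_le[where P="\<lambda>k::nat. t \<le> len (g [^] k)", OF tn] by (auto simp: k_def)
  show ?thesis
  proof (cases k)
    case 0
    then show ?thesis using k nonneg delta_nonneg by (simp flip: t_def)
  next
    case (Suc j)
    have "len (g [^] j) < t"
      using not_less_Least[of j "\<lambda>k::nat. t \<le> len (g [^] k)"] Suc by (auto simp: k_def)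
    then have up: "len (g [^] k) \<le> t + len g"
      using len_mult[of "g [^] j" g] g Suc by simp
    let ?a = "g [^] k"
    have a: "?a \<in> carrier G" using g by simp
    have "g [^] n = ?a \<otimes> g [^] (n - k)" using k g by (simp add: nat_pow_mult)
    then have "gp \<one> ?a (g [^] n) = len ?a - gp \<one> (inv ?a) (g [^] (n - k))"
      using gp_one_mult[OF a, of "g [^] (n - k)"] g by simp
    moreover have "gp \<one> (inv ?a) (g [^] (n - k)) \<le> gp \<one> g (inv g) + 2 * \<delta>"
      using axial_two_sided[OF assms(1), of "n - k" k] g a gp_commute[of "inv ?a" "g [^] (n - k)" \<one>]
      by (simp add: nat_pow_inv)
    ultimately have "t - gp \<one> g (inv g) - 3 * \<delta> \<le> gp \<one> y ?a"
      using hyperbolic[of \<one> y "g [^] n" ?a] gp_commute[of ?a "g [^] n" \<one>] k(1) y g a nonneg delta_nonneg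
      by (auto simp: min_def simp flip: t_def split: if_splits)
    then show ?thesis
      using dst_gp[of y ?a] near[of k] up y a by (simp flip: t_def)
  qed
qed

text \<open>Split a long geodesic word as \<open>u v\<close>. If neither \<open>inv u\<close> nor \<open>v\<close> is axial, each of them nearly points in
  the direction of its inverse, and then \<open>inv u \<otimes> v\<close> is axial.\<close>

lemma axial_exists:
  assumes inf: "infinite (carrier G)"
  shows "\<exists>g. axial g"
proof -
  \<comment> \<open>The multiple of \<open>\<delta>\<close> is chosen so that
    \<open>(M - 3 * \<delta>) / 2 - \<delta>\<close> exceeds \<open>2 * \<delta>\<close>
    below.\<close>
  obtain M :: nat where M: "9 * \<delta> + 1 \<le> real M" using real_arch_simple by blast
  have "\<not> carrier G \<subseteq> len_ball (2 * M)" using inf finite_len_ball finite_subset by blast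
  then obtain w0 where w0: "w0 \<in> carrier G" "2 * M \<le> len w0" by (force simp: len_ball_def)
  then obtain w where w: "w \<in> carrier G" "len w = 2 * M" using len_split[of w0 "2 * M"] by blast
  then obtain u v where uv: "u \<in> carrier G" "v \<in> carrier G" "w = u \<otimes> v" "len u = M" "len v = M"
    using len_split[of w M] by auto
  define h1 h2 where "h1 = inv u" and "h2 = v"
  have h: "h1 \<in> carrier G" "h2 \<in> carrier G" "len h1 = M" "len h2 = M"
    using uv by (auto simp: h1_def h2_def)
  have h12: "gp \<one> h1 h2 = 0"
    using len_mult_gp[OF uv(1,2)] uv w by (simp add: h1_def h2_def)
  show ?thesis
  proof (rule ccontr)
    assume no: "\<not> ?thesis"
    have big: "(M - 3 * \<delta>) / 2 \<le> gp \<one> h1 (inv h1)" "(M - 3 * \<delta>) / 2 \<le> gp \<one> h2 (inv h2)"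
      using no h by (auto simp: axial_def not_less field_simps)
    define g where "g = h1 \<otimes> h2"
    have g: "g \<in> carrier G" "inv g = inv h2 \<otimes> inv h1" using h by (auto simp: g_def inv_mult_group)
    \<comment> \<open>\<open>inv h1\<close> points in the direction of \<open>h1\<close>, hence away
      from \<open>h2\<close>, so \<open>h1 \<otimes> h2\<close> has almost no cancellation.\<close>
    have a: "gp \<one> (inv h1) h2 \<le> \<delta>"
      using hyperbolic[of \<one> h1 "inv h1" h2] h h12 big M delta_nonneg
      by (auto simp: min_def split: if_splits)
    have b: "2 * M - 2 * \<delta> \<le> len g" using len_mult_gp[OF h(1,2)] a h by (simp add: g_def)
    have c: "M - \<delta> \<le> gp \<one> h1 g" using gp_one_mult[OF h(1,2)] a h by (simp add: g_def)
    have d: "M - \<delta> \<le> gp \<one> (inv h2) (inv g)"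
      using gp_one_mult[of "inv h2" "inv h1"] a h g gp_commute[of h2 "inv h1" \<one>] by simp
    \<comment> \<open>\<open>inv g\<close> starts like \<open>inv h2\<close>, hence like
      \<open>h2\<close>, whereas \<open>g\<close> starts like \<open>h1\<close>.\<close>
    have f: "2 * \<delta> < gp \<one> h2 (inv g)"
      using hyperbolic[of \<one> h2 "inv h2" "inv g"] big d M h g delta_nonneg
      by (auto simp: min_def split: if_splits)
    have "gp \<one> h1 (inv g) \<le> \<delta>"
      using hyperbolic[of \<one> h1 "inv g" h2] f h g h12 delta_nonneg gp_commute[of h2 "inv g" \<one>]
      by (auto simp: min_def split: if_splits)
    then have "gp \<one> g (inv g) \<le> 2 * \<delta>"
      using hyperbolic[of \<one> h1 g "inv g"] c M h g delta_nonneg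
      by (auto simp: min_def split: if_splits)
    then have "axial g" using b g M delta_nonneg by (auto simp: axial_def)
    then show False using no by blast
  qed
qed

end

section \<open>Exponential growth of non-elementary groups\<close>

lemma (in word_metric_group) infinite_of_not_elementary:
  assumes "\<not> elementary_group G" shows "infinite (carrier G)"
proof
  assume "finite (carrier G)"
  then have "finite (rcosets (generate G {\<one>}))" by (simp add: RCOSETS_def)
  then show False using assms one_closed unfolding elementary_group_def by blast
qed

text \<open>If all of \<open>G\<close> were within \<open>D\<close> of the cyclic subgroup, a finite
  ball would represent all of its cosets. So some \<open>x\<close> is far from it, and translating a
  nearest point of the subgroup to \<open>\<one>\<close> gives \<open>y\<close>.\<close>

lemma (in word_metric_group) far_from_cyclic:
  assumes "\<not> elementary_group G" and g: "g \<in> carrier G"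
  shows "\<exists>y\<in>carrier G. D < len y \<and> (\<forall>h\<in>generate G {g}. len y \<le> dst y h)"
proof -
  let ?H = "generate G {g}"
  have sub: "subgroup ?H G" using g generate_is_subgroup by simp
  then have H: "?H \<subseteq> carrier G" using subgroup.subset by blast
  have "\<exists>x\<in>carrier G. \<forall>h\<in>?H. D < dst x h"
  proof (rule ccontr)
    assume "\<not> ?thesis"
    then have near: "\<exists>h\<in>?H. dst x h \<le> D" if "x \<in> carrier G" for x using that by (force simp: not_less)
    have "rcosets ?H \<subseteq> (\<lambda>b. ?H #> b) ` len_ball D"
    proof
      fix C assume "C \<in> rcosets ?H"
      then obtain x where x: "x \<in> carrier G" "C = ?H #> x" by (auto simp: RCOSETS_def)
      obtain h where h: "h \<in> ?H" "dst x h \<le> D" using near x by blast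
      have hc: "h \<in> carrier G" using h H by blast
      define b where "b = inv h \<otimes> x"
      have b: "b \<in> len_ball D" using h x hc dst_commute[of x h]
        by (simp add: b_def len_ball_def word_dist_def)
      have "?H #> b = (?H #> inv h) #> x" using x hc H by (simp add: b_def coset_mult_assoc)
      also have "?H #> inv h = ?H"
        using sub h(1) by (metis coset_join2 hc inv_closed subgroup.m_inv_closed)
      finally show "C \<in> (\<lambda>b. ?H #> b) ` len_ball D" using x b by blast
    qed
    then have "finite (rcosets ?H)" by (rule finite_subset) simp
    then show False using assms unfolding elementary_group_def by blast
  qed
  then obtain x where x: "x \<in> carrier G" "\<And>h. h \<in> ?H \<Longrightarrow> D < dst x h" by blast
  obtain h where h: "h \<in> ?H" "\<And>h'. h' \<in> ?H \<Longrightarrow> dst x h \<le> dst x h'"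
    using ex_has_least_nat[of "\<lambda>h. h \<in> ?H" _ "dst x"] generate.one by metis
  have hc: "h \<in> carrier G" using h H by blast
  define y where "y = inv h \<otimes> x"
  have y: "y \<in> carrier G" "len y = dst x h"
    using x hc dst_commute[of x h] by (auto simp: y_def word_dist_def)
  have "len y \<le> dst y k" if k: "k \<in> ?H" for k
  proof -
    have kc: "k \<in> carrier G" using k H by blast
    have "dst y k = dst (h \<otimes> y) (h \<otimes> k)" using y hc kc by simp
    also have "\<dots> = dst x (h \<otimes> k)" using x hc by (simp add: y_def mult_inv_cancel)
    finally show ?thesis using h(2)[of "h \<otimes> k"] sub h(1) k y by (simp add: subgroup.m_closed)
  qed
  then show ?thesis using y x(2)[OF h(1)] by (intro bexI[of _ y]) auto
qed

lemma (in group) nat_pow_in_generate: "g \<in> carrier G \<Longrightarrow> h \<in> generate G {g} \<Longrightarrow> h [^] (n::nat) \<in> generate G {g}"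
  by (induction n) (auto intro: generate.intros)

context hyperbolic_word_group
begin

lemma exponential_growth:
  assumes "\<not> elementary_group G"
  shows "\<exists>P. \<forall>n. 2 ^ n \<le> card (len_ball (n * P))"
proof -
  obtain g where ax: "axial g"
    using axial_exists infinite_of_not_elementary[OF assms] by blast
  then have g: "g \<in> carrier G" by (simp add: axial_def)
  define e where "e = gp \<one> g (inv g)"
  have e: "0 \<le> e" using g gp_nonneg by (simp add: e_def)
  \<comment> \<open>This is the bound of \<open>axial_nearest\<close>; it also dominates the bound
    \<open>e + 2 * \<delta>\<close> of \<open>axial_two_sided\<close>.\<close>
  define c where "c = len g + 2 * e + 6 * \<delta>"
  have c: "0 \<le> c" using e delta_nonneg by (simp add: c_def)
  obtain M :: nat where M: "2 * c + 5 * \<delta> < M" using reals_Archimedean2 by blast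
  then have cM: "c < M" using c delta_nonneg by simp
  obtain y where y: "y \<in> carrier G" "M < len y" "\<And>h. h \<in> generate G {g} \<Longrightarrow> len y \<le> dst y h"
    using far_from_cyclic[OF assms g] by metis
  define \<kappa> where "\<kappa> = len g - 2 * e - 2 * \<delta>"
  have \<kappa>: "0 < \<kappa>" using ax delta_nonneg by (simp add: axial_def \<kappa>_def e_def)
  then obtain n :: nat where n: "M < n * \<kappa>" using reals_Archimedean3 by blast
  define a b where "a = g [^] n" and "b = inv g [^] n"
  have ab: "a \<in> carrier G" "b \<in> carrier G" using g by (auto simp: a_def b_def)
  have "M < len a"
    using axial_len_pow[OF ax, of n] n by (simp add: a_def \<kappa>_def e_def)
  moreover have "len b = len a" using g ab by (simp add: a_def b_def nat_pow_inv)
  ultimately have len: "M < len a" "M < len b" by auto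
  have "inv g \<in> generate G {g}" by (intro generate.intros) simp
  then have pw: "g [^] k \<in> generate G {g}" "inv g [^] k \<in> generate G {g}" for k :: nat
    using nat_pow_in_generate[OF g] by (auto intro: generate.intros)
  have ya: "gp \<one> y a \<le> c"
    using axial_nearest[OF ax y(1) y(3)[OF pw(1)]] by (simp add: a_def c_def e_def)
  have yb: "gp \<one> y b \<le> c"
    using axial_nearest[OF axial_inv[OF ax] y(1) y(3)[OF pw(2)]] gp_commute[of g "inv g" \<one>] g
    by (simp add: b_def c_def e_def)
  have ab': "gp \<one> a b \<le> c"
    using axial_two_sided[OF ax, of n n] delta_nonneg e by (simp add: a_def b_def c_def e_def)
  have self: "gp \<one> x x = len x" if "x \<in> carrier G" for x using that by (simp add: gp_self)
  \<comment> \<open>Equal elements would have their own length as product, and that exceeds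
    \<open>M\<close> and hence \<open>c\<close>.\<close>
  have ne: "y \<noteq> a" "y \<noteq> b" "a \<noteq> b"
    using ya yb ab' self[of y] self[of a] y(1,2) ab len cM by force+
  define P where "P = len y + len a + len b"
  have "2 ^ n \<le> card (len_ball (n * P))" for n
  proof (rule len_ball_growth[where Y="{y, a, b}" and M=M and c=c])
    show "gp \<one> x z \<le> c" if "x \<in> {y, a, b}" "z \<in> {y, a, b}" "x \<noteq> z" for x z
      using that ya yb ab' gp_commute[OF y(1) ab(1), of \<one>] gp_commute[OF y(1) ab(2), of \<one>]
        gp_commute[OF ab, of \<one>] by auto
  qed (use y ab ne len c M in \<open>auto simp: P_def\<close>)
  then show ?thesis by blast
qed

theorem linear_isoperimetric_inequality:
  assumes "\<not> elementary_group G"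
  shows "\<exists>c>0. \<forall>F. finite F \<longrightarrow> F \<subseteq> carrier G \<longrightarrow> c * real (card F) \<le> real (card (cut_edges F))"
  using exponential_growth[OF assms] drift isoperimetric_of_drift by metis

end

section \<open>Minimisers of the edge boundary\<close>

lemma has_integral_step:
  fixes v M :: real
  assumes "0 \<le> v" "v \<le> M"
  shows "((\<lambda>t. if t < v then 1 else 0 :: real) has_integral v) {0..M}"
proof -
  have 1: "((\<lambda>t. if t < v then 1 else 0 :: real) has_integral v) {0..v}"
  proof (rule has_integral_spike_finite)
    show "((\<lambda>_. 1 :: real) has_integral v) {0..v}"
      using has_integral_const_real[of "1::real" 0 v] assms by simp
    show "finite {v}" by simp
  qed auto
  have 2: "((\<lambda>t. if t < v then 1 else 0 :: real) has_integral 0) {v..M}"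
    by (intro has_integral_is_0) auto
  show ?thesis using has_integral_combine[OF assms 1 2] by simp
qed

text \<open>Integrate the inequality over \<open>t\<close> from 0 to a common upper bound
  \<open>M\<close>; each indicator of \<open>t < v\<close> integrates to \<open>v\<close>.\<close>

lemma layer_cake_le:
  fixes c :: real and f :: "'b \<Rightarrow> real" and g h :: "'c \<Rightarrow> real"
  assumes A: "finite A" and B: "finite B"
    and f: "\<And>x. x \<in> A \<Longrightarrow> 0 \<le> f x" and g: "\<And>x. x \<in> B \<Longrightarrow> 0 \<le> g x"
    and h: "\<And>x. x \<in> B \<Longrightarrow> 0 \<le> h x"
    and level: "\<And>t. 0 \<le> t \<Longrightarrow> c * (\<Sum>x\<in>A. if t < f x then 1 else 0) \<le>
      d * (\<Sum>x\<in>B. (if t < g x then 1 else 0) - (if t < h x then 1 else 0))"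
  shows "c * (\<Sum>x\<in>A. f x) \<le> d * (\<Sum>x\<in>B. g x - h x)"
proof -
  \<comment> \<open>Inserting 0 keeps the maximum defined when both index sets are empty.\<close>
  define M where "M = Max (insert 0 (f ` A \<union> g ` B \<union> h ` B))"
  have M: "\<And>x. x \<in> A \<Longrightarrow> f x \<le> M" "\<And>x. x \<in> B \<Longrightarrow> g x \<le> M" "\<And>x. x \<in> B \<Longrightarrow> h x \<le> M"
    using A B by (auto simp: M_def)
  show ?thesis
  proof (rule has_integral_le)
    show "((\<lambda>t. c * (\<Sum>x\<in>A. if t < f x then 1 else 0)) has_integral c * (\<Sum>x\<in>A. f x)) {0..M}"
      using A f M by (intro has_integral_mult_right has_integral_sum has_integral_step) auto
    show "((\<lambda>t. d * (\<Sum>x\<in>B. (if t < g x then 1 else 0) - (if t < h x then 1 else 0)))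
        has_integral d * (\<Sum>x\<in>B. g x - h x)) {0..M}"
      using B g h M
      by (intro has_integral_mult_right has_integral_sum has_integral_diff has_integral_step) auto
  qed (use level in auto)
qed

lemma power_diff_le:
  fixes a b :: real
  assumes "0 \<le> b" "b \<le> a"
  shows "a ^ Suc n - b ^ Suc n \<le> Suc n * a ^ n * (a - b)"
proof (induction n)
  case (Suc n)
  have "a ^ Suc (Suc n) - b ^ Suc (Suc n) = a * (a ^ Suc n - b ^ Suc n) + (a - b) * b ^ Suc n"
    by (simp add: algebra_simps)
  also have "\<dots> \<le> a * (Suc n * a ^ n * (a - b)) + (a - b) * a ^ Suc n"
    using Suc assms by (intro add_mono mult_left_mono power_mono) auto
  also have "\<dots> = Suc (Suc n) * a ^ Suc n * (a - b)" by (simp add: algebra_simps)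
  finally show ?case .
qed simp

text \<open>A jump of size at most \<open>C r\<close> is relatively small where \<open>a\<close> exceeds \<open>K r\<close>; elsewhere it is
  bounded in terms of \<open>r\<close> alone.\<close>

lemma power_diff_split:
  fixes a b C K r :: real
  assumes "0 \<le> b" "b \<le> a" "a - b \<le> C * r" "0 < K" "0 \<le> C" "0 \<le> r"
  shows "a ^ Suc n - b ^ Suc n \<le> (Suc n * C / K) * a ^ Suc n + (Suc n * C * K ^ n) * r ^ Suc n"
proof -
  have "a ^ Suc n - b ^ Suc n \<le> Suc n * a ^ n * (a - b)" using assms power_diff_le by blast
  also have "\<dots> \<le> Suc n * a ^ n * (C * r)" using assms by (intro mult_left_mono) auto
  finally have *: "a ^ Suc n - b ^ Suc n \<le> Suc n * a ^ n * (C * r)" .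
  show ?thesis
  proof (cases "K * r \<le> a")
    case True
    then have "r \<le> a / K" using assms by (simp add: field_simps)
    then have "Suc n * a ^ n * (C * r) \<le> Suc n * a ^ n * (C * (a / K))"
      using assms by (intro mult_left_mono) auto
    also have "\<dots> = (Suc n * C / K) * a ^ Suc n" by simp
    finally show ?thesis using * assms by (smt (verit) mult_nonneg_nonneg of_nat_0_le_iff zero_le_power)
  next
    case False
    then have "a ^ n \<le> (K * r) ^ n" using assms by (intro power_mono) auto
    then have "Suc n * a ^ n * (C * r) \<le> Suc n * (K * r) ^ n * (C * r)"
      using assms by (intro mult_right_mono mult_left_mono) auto
    also have "\<dots> = (Suc n * C * K ^ n) * r ^ Suc n" by (simp add: power_mult_distrib)
    finally have "a ^ Suc n - b ^ Suc n \<le> (Suc n * C * K ^ n) * r ^ Suc n" using * by linarith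
    moreover have "0 \<le> (Suc n * C / K) * a ^ Suc n" using assms by simp
    ultimately show ?thesis by linarith
  qed
qed

text \<open>Diagonal extraction for indicator functions: a convergent sequence of zeros and ones is
  eventually constant, and the constants define the limit set.\<close>

lemma convergent_subsequence_sets:
  fixes E :: "nat \<Rightarrow> 'a set"
  assumes "countable V"
  shows "\<exists>k D. strict_mono (k::nat \<Rightarrow> nat) \<and> D \<subseteq> V \<and>
    (\<forall>x\<in>V. eventually (\<lambda>n. x \<in> E (k n) \<longleftrightarrow> x \<in> D) sequentially)"
proof -
  have "norm (indicator (E n) x :: real) \<le> 1" for n x by (simp add: indicator_def)
  then obtain k where k: "strict_mono (k::nat \<Rightarrow> nat)"
    "\<And>x. x \<in> V \<Longrightarrow> \<exists>l::real. (\<lambda>n. indicator (E (k n)) x) \<longlonglongrightarrow> l"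
    using function_convergent_subsequence[OF assms, of "\<lambda>n x. indicator (E n) x :: real" 1] by metis
  define D where "D = {x \<in> V. eventually (\<lambda>n. x \<in> E (k n)) sequentially}"
  have "eventually (\<lambda>n. x \<in> E (k n) \<longleftrightarrow> x \<in> D) sequentially" if x: "x \<in> V" for x
  proof -
    obtain l :: real where l: "(\<lambda>n. indicator (E (k n)) x) \<longlonglongrightarrow> l" using k(2)[OF x] by blast
    show ?thesis
    proof (cases "0 < l")
      case True
      then have "eventually (\<lambda>n. 0 < (indicator (E (k n)) x :: real)) sequentially"
        using l by (rule order_tendstoD(1)[rotated])
      then have "eventually (\<lambda>n. x \<in> E (k n)) sequentially"
        by (rule eventually_mono) (auto simp: indicator_def split: if_splits)
      then show ?thesis using x by (auto simp: D_def elim: eventually_mono)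
    next
      case False
      then have "eventually (\<lambda>n. (indicator (E (k n)) x :: real) < 1) sequentially"
        using l by (intro order_tendstoD(2)) auto
      then have ev: "eventually (\<lambda>n. x \<notin> E (k n)) sequentially"
        by (rule eventually_mono) (auto simp: indicator_def split: if_splits)
      have "x \<notin> D"
      proof
        assume "x \<in> D"
        then have "eventually (\<lambda>n. x \<in> E (k n)) sequentially" by (simp add: D_def)
        with ev have "eventually (\<lambda>n. False) sequentially" by eventually_elim auto
        then show False by simp
      qed
      then show ?thesis using ev by (auto elim: eventually_mono)
    qed
  qed
  then show ?thesis using k(1) by (intro exI[of _ k] exI[of _ D]) (auto simp: D_def)
qed

section \<open>Sets of minimal edge boundary in finite windows\<close>

context word_metric_group
begin

text \<open>Only the inequality for one of the two sides of a partition; by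
  \<open>boundary_size_compl\<close> the other side has the same boundary size.\<close>

definition minimal_in :: "'a set \<Rightarrow> 'a set \<Rightarrow> bool" where
  "minimal_in \<Omega> E \<longleftrightarrow> (\<forall>B\<subseteq>carrier G. B \<inter> (carrier G - inner_part G S \<Omega>) =
      E \<inter> (carrier G - inner_part G S \<Omega>) \<longrightarrow> boundary_size G S \<Omega> E \<le> boundary_size G S \<Omega> B)"

definition boundary_edges :: "'a set \<Rightarrow> 'a set \<Rightarrow> ('a \<times> 'a) set" where
  "boundary_edges \<Omega> B = {(g, h). g \<in> \<Omega> \<and> h \<in> \<Omega> \<and> adjacent g h \<and> g \<in> B \<and> h \<notin> B}"

lemma boundary_size_eq: "boundary_size G S \<Omega> B = card (boundary_edges \<Omega> B)"
  by (simp add: boundary_size_def boundary_edges_def adjacent_def)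

lemma finite_boundary_edges: "finite \<Omega> \<Longrightarrow> finite (boundary_edges \<Omega> B)"
  by (rule finite_subset[of _ "\<Omega> \<times> \<Omega>"]) (auto simp: boundary_edges_def)

lemma inner_part_subset: "inner_part G S \<Omega> \<subseteq> \<Omega>"
  by (auto simp: inner_part_def)

lemma inner_part_adjacent: "g \<in> inner_part G S \<Omega> \<Longrightarrow> adjacent g h \<Longrightarrow> h \<in> \<Omega>"
  by (auto simp: inner_part_def adjacent_def)

text \<open>Reversing edges is a bijection, because the generating set is symmetric.\<close>

lemma boundary_size_compl:
  assumes "\<Omega> \<subseteq> carrier G"
  shows "boundary_size G S \<Omega> (carrier G - B) = boundary_size G S \<Omega> B"
proof -
  have "(g, h) \<in> boundary_edges \<Omega> (carrier G - B) \<longleftrightarrow> (h, g) \<in> boundary_edges \<Omega> B" for g h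
    using assms adjacent_sym[of g h] adjacent_sym[of h g] by (auto simp: boundary_edges_def)
  then have "boundary_edges \<Omega> (carrier G - B) = (boundary_edges \<Omega> B)\<inverse>" by auto
  then show ?thesis by (simp add: boundary_size_eq card_inverse)
qed

lemma minimal_in_compl:
  assumes "minimal_in \<Omega> E" "E \<subseteq> carrier G" "\<Omega> \<subseteq> carrier G"
  shows "minimal_in \<Omega> (carrier G - E)"
  unfolding minimal_in_def
proof (intro allI impI)
  fix B assume B: "B \<subseteq> carrier G" "B \<inter> (carrier G - inner_part G S \<Omega>) =
    (carrier G - E) \<inter> (carrier G - inner_part G S \<Omega>)"
  then have "(carrier G - B) \<inter> (carrier G - inner_part G S \<Omega>) = E \<inter> (carrier G - inner_part G S \<Omega>)"
    using assms(2) by auto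
  then show "boundary_size G S \<Omega> (carrier G - E) \<le> boundary_size G S \<Omega> B"
    using assms(1) boundary_size_compl[OF assms(3)] unfolding minimal_in_def by (metis Diff_subset)
qed

text \<open>A competitor in the small window is one in the large window. The remaining edges of the
  large window have both ends off the inner part of \<open>\<Omega>\<close>, where \<open>B\<close>
  and \<open>E\<close> agree, so they contribute equally.\<close>

lemma minimal_in_subset:
  assumes min: "minimal_in \<Omega>' E" and sub: "\<Omega> \<subseteq> \<Omega>'" "\<Omega>' \<subseteq> carrier G" "finite \<Omega>'"
  shows "minimal_in \<Omega> E"
  unfolding minimal_in_def
proof (intro allI impI)
  fix B assume B: "B \<subseteq> carrier G"
    "B \<inter> (carrier G - inner_part G S \<Omega>) = E \<inter> (carrier G - inner_part G S \<Omega>)"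
  then have agree: "x \<in> B \<longleftrightarrow> x \<in> E" if "x \<in> carrier G" "x \<notin> inner_part G S \<Omega>" for x
    using that by blast
  have "inner_part G S \<Omega> \<subseteq> inner_part G S \<Omega>'" using sub by (auto simp: inner_part_def)
  then have "boundary_size G S \<Omega>' E \<le> boundary_size G S \<Omega>' B"
    using min B unfolding minimal_in_def by blast
  moreover have "boundary_size G S \<Omega>' X = boundary_size G S \<Omega> X +
      card (boundary_edges \<Omega>' X - \<Omega> \<times> \<Omega>)" for X
  proof -
    have "boundary_edges \<Omega>' X = boundary_edges \<Omega> X \<union> (boundary_edges \<Omega>' X - \<Omega> \<times> \<Omega>)"
      using sub by (auto simp: boundary_edges_def)
    moreover have "boundary_edges \<Omega> X \<inter> (boundary_edges \<Omega>' X - \<Omega> \<times> \<Omega>) = {}"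
      by (auto simp: boundary_edges_def)
    ultimately show ?thesis
      using sub finite_boundary_edges finite_subset unfolding boundary_size_eq
      by (metis card_Un_disjoint finite_Diff)
  qed
  moreover have "boundary_edges \<Omega>' E - \<Omega> \<times> \<Omega> = boundary_edges \<Omega>' B - \<Omega> \<times> \<Omega>"
  proof -
    have "(g \<in> E \<longleftrightarrow> g \<in> B) \<and> (h \<in> E \<longleftrightarrow> h \<in> B)"
      if gh: "g \<in> \<Omega>'" "h \<in> \<Omega>'" "adjacent g h" "\<not> (g \<in> \<Omega> \<and> h \<in> \<Omega>)" for g h
    proof -
      have "adjacent h g" using gh adjacent_sym sub by blast
      then have "g \<notin> inner_part G S \<Omega>" "h \<notin> inner_part G S \<Omega>"
        using gh inner_part_adjacent inner_part_subset by blast+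
      then show ?thesis using agree gh sub by blast
    qed
    then show ?thesis unfolding boundary_edges_def by blast
  qed
  ultimately show "boundary_size G S \<Omega> E \<le> boundary_size G S \<Omega> B" by simp
qed

text \<open>Minimality depends on the set inside the window only. Hence it passes to a pointwise
  limit, which agrees with some approximating set on any finite window.\<close>

lemma minimal_in_cong:
  assumes min: "minimal_in \<Omega> E" and E: "E \<subseteq> carrier G" and eq: "E \<inter> \<Omega> = E' \<inter> \<Omega>"
  shows "minimal_in \<Omega> E'"
  unfolding minimal_in_def
proof (intro allI impI)
  have local: "boundary_size G S \<Omega> X = boundary_size G S \<Omega> Y" if "X \<inter> \<Omega> = Y \<inter> \<Omega>" for X Y
  proof -
    have "boundary_edges \<Omega> X = boundary_edges \<Omega> Y" using that unfolding boundary_edges_def by blast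
    then show ?thesis by (simp add: boundary_size_eq)
  qed
  fix B assume B: "B \<subseteq> carrier G"
    "B \<inter> (carrier G - inner_part G S \<Omega>) = E' \<inter> (carrier G - inner_part G S \<Omega>)"
  define B' where "B' = (B \<inter> \<Omega>) \<union> (E - \<Omega>)"
  have "B' \<subseteq> carrier G"
    "B' \<inter> (carrier G - inner_part G S \<Omega>) = E \<inter> (carrier G - inner_part G S \<Omega>)"
    using B E eq by (auto simp: B'_def)
  then have "boundary_size G S \<Omega> E \<le> boundary_size G S \<Omega> B'"
    using min unfolding minimal_in_def by blast
  moreover have "boundary_size G S \<Omega> B' = boundary_size G S \<Omega> B" by (rule local) (auto simp: B'_def)
  ultimately show "boundary_size G S \<Omega> E' \<le> boundary_size G S \<Omega> B" using local[OF eq] by simp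
qed

lemma minimizer_exists:
  assumes "A \<subseteq> carrier G"
  shows "\<exists>E\<subseteq>carrier G. E \<inter> (carrier G - inner_part G S \<Omega>) = A \<inter> (carrier G - inner_part G S \<Omega>) \<and>
    minimal_in \<Omega> E"
proof -
  let ?P = "\<lambda>E. E \<subseteq> carrier G \<and> E \<inter> (carrier G - inner_part G S \<Omega>) = A \<inter> (carrier G - inner_part G S \<Omega>)"
  obtain E where E: "?P E" "\<And>B. ?P B \<Longrightarrow> boundary_size G S \<Omega> E \<le> boundary_size G S \<Omega> B"
    using ex_has_least_nat[of ?P A "boundary_size G S \<Omega>"] assms by blast
  then show ?thesis unfolding minimal_in_def by (intro exI[of _ E]) auto
qed

text \<open>Compare \<open>E\<close> with \<open>E \<union> F\<close>: the edges from
  \<open>E\<close> into \<open>F\<close> disappear, those from \<open>F\<close> out of the union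
  appear, and the edges in \<open>X\<close> are common to both.\<close>

lemma minimal_in_union:
  assumes min: "minimal_in \<Omega> E" and E: "E \<subseteq> carrier G" and \<Omega>: "finite \<Omega>" "\<Omega> \<subseteq> carrier G"
    and F: "F \<subseteq> inner_part G S \<Omega>" "F \<inter> E = {}"
  shows "card {(p, q). p \<in> F \<and> q \<in> E \<and> adjacent p q} \<le>
         card {(p, q). p \<in> F \<and> q \<notin> E \<union> F \<and> adjacent p q}"
proof -
  have FO: "F \<subseteq> \<Omega>" using F inner_part_subset by blast
  define X where "X = {(g, h) \<in> boundary_edges \<Omega> E. h \<notin> F}"
  define P where "P = {(p, q). p \<in> F \<and> q \<in> E \<and> adjacent p q}"
  define Q where "Q = {(p, q). p \<in> F \<and> q \<notin> E \<union> F \<and> adjacent p q}"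
  \<comment> \<open>Since \<open>F\<close> lies in the inner part, the window contains every edge at
    \<open>F\<close>.\<close>
  have nbr: "q \<in> \<Omega>" if "p \<in> F" "adjacent p q" for p q using that F inner_part_adjacent by blast
  have fin: "finite X" "finite P" "finite Q"
  proof -
    show "finite X" using finite_boundary_edges[OF \<Omega>(1), of E] by (rule finite_subset[rotated]) (auto simp: X_def)
    have "P \<subseteq> \<Omega> \<times> \<Omega>" "Q \<subseteq> \<Omega> \<times> \<Omega>" using nbr FO unfolding P_def Q_def by blast+
    then show "finite P" "finite Q" using \<Omega>(1) finite_subset[OF _ finite_cartesian_product] by metis+
  qed
  have "boundary_edges \<Omega> E = X \<union> P\<inverse>"
  proof -
    have "(g, h) \<in> boundary_edges \<Omega> E \<longleftrightarrow> (g, h) \<in> X \<or> (h, g) \<in> P" for g h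
    proof -
      have "h \<in> F \<Longrightarrow> h \<in> \<Omega> \<and> h \<notin> E" "g \<in> E \<Longrightarrow> g \<in> carrier G" "h \<in> F \<Longrightarrow> h \<in> carrier G"
        using F FO E \<Omega> by blast+
      then show ?thesis
        using nbr[of h g] adjacent_sym[of g h] adjacent_sym[of h g]
        by (simp add: X_def P_def boundary_edges_def) blast
    qed
    then show ?thesis by auto
  qed
  moreover have "X \<inter> P\<inverse> = {}" by (auto simp: X_def P_def)
  ultimately have 1: "boundary_size G S \<Omega> E = card X + card P"
    using fin by (simp add: boundary_size_eq card_Un_disjoint card_inverse)
  have "boundary_edges \<Omega> (E \<union> F) = X \<union> Q"
    using FO nbr F(2) unfolding X_def Q_def boundary_edges_def by blast
  moreover have "X \<inter> Q = {}" using F by (auto simp: X_def Q_def boundary_edges_def)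
  ultimately have 2: "boundary_size G S \<Omega> (E \<union> F) = card X + card Q"
    using fin by (simp add: boundary_size_eq card_Un_disjoint)
  have "(E \<union> F) \<inter> (carrier G - inner_part G S \<Omega>) = E \<inter> (carrier G - inner_part G S \<Omega>)"
    using F by blast
  moreover have "E \<union> F \<subseteq> carrier G" using E FO \<Omega> by blast
  ultimately have "boundary_size G S \<Omega> E \<le> boundary_size G S \<Omega> (E \<union> F)"
    using min unfolding minimal_in_def by blast
  then show ?thesis using 1 2 by (simp add: P_def Q_def)
qed

text \<open>At most \<open>card S ^ k\<close> elements have length \<open>k\<close>, so a geometric
  series of ratio \<open>1 / 2\<close> dominates the sum.\<close>

lemma sum_power_len_le:
  fixes w :: real
  assumes F: "finite F" "F \<subseteq> carrier G" and w: "0 \<le> w" "card S * w \<le> 1 / 2"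
  shows "(\<Sum>x\<in>F. w ^ len x) \<le> 2"
proof -
  define n where "n = Max (insert 0 (len ` F))"
  have n: "len x \<le> n" if "x \<in> F" for x using F that by (simp add: n_def)
  have "(\<Sum>x\<in>F. w ^ len x) = (\<Sum>k\<le>n. \<Sum>x\<in>{x\<in>F. len x = k}. w ^ len x)"
    using F n by (intro sum.group[symmetric]) auto
  also have "\<dots> = (\<Sum>k\<le>n. card {x\<in>F. len x = k} * w ^ k)" by simp
  also have "\<dots> \<le> (\<Sum>k\<le>n. (1 / 2) ^ k)"
  proof (rule sum_mono)
    fix k
    have "card {x\<in>F. len x = k} \<le> card {g \<in> carrier G. len g = k}"
      using F finite_len_sphere by (intro card_mono) auto
    then have "card {x\<in>F. len x = k} \<le> card S ^ k" using card_len_sphere[of k] by simp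
    then have "real (card {x\<in>F. len x = k}) * w ^ k \<le> real (card S ^ k) * w ^ k"
      using w by (intro mult_right_mono) auto
    also have "\<dots> = (card S * w) ^ k" by (simp add: power_mult_distrib)
    also have "\<dots> \<le> (1 / 2) ^ k" using w by (intro power_mono) auto
    finally show "real (card {x\<in>F. len x = k}) * w ^ k \<le> (1 / 2) ^ k" .
  qed
  also have "\<dots> = 2 - (1 / 2) ^ n" by (induction n) (auto simp: field_simps)
  finally show ?thesis by (smt (verit) zero_le_power divide_nonneg_nonneg)
qed

section \<open>The energy bound\<close>

definition slowly_varying :: "real \<Rightarrow> real \<Rightarrow> ('a \<Rightarrow> real) \<Rightarrow> bool" where
  "slowly_varying C q u \<longleftrightarrow>
     (\<forall>x\<in>carrier G. \<forall>y. adjacent x y \<longrightarrow> \<bar>u x - u y\<bar> \<le> C * q ^ len x)"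

text \<open>The last clause is the part of the boundary data that the comparison uses: points of
  positive \<open>u\<close> missing from \<open>E\<close> may be added to it without touching the
  data.\<close>

definition minimal_with_data :: "('a \<Rightarrow> real) \<Rightarrow> 'a set \<Rightarrow> 'a set \<Rightarrow> bool" where
  "minimal_with_data u \<Omega> E \<longleftrightarrow> finite \<Omega> \<and> \<Omega> \<subseteq> carrier G \<and> E \<subseteq> carrier G \<and> minimal_in \<Omega> E \<and>
     (\<forall>x\<in>carrier G - E. 0 < u x \<longrightarrow> x \<in> inner_part G S \<Omega>)"

text \<open>By minimality, at least half of the edges leaving a superlevel set outside
  \<open>E\<close> do not end in \<open>E\<close>, so \<open>\<phi>\<close> drops along them and its
  gradient pays for the isoperimetric inequality. It matters that \<open>n\<close> and
  \<open>b\<close> do not depend on \<open>u\<close>, \<open>\<Omega>\<close> or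
  \<open>E\<close>.\<close>

lemma minimal_energy_bound:
  assumes c: "0 < c" and iso: "\<And>F. finite F \<Longrightarrow> F \<subseteq> carrier G \<Longrightarrow> c * real (card F) \<le> card (cut_edges F)"
    and q: "0 < q" "q < 1" and C: "0 \<le> C"
  shows "\<exists>n b. \<forall>u \<Omega> E K. slowly_varying C q u \<longrightarrow> minimal_with_data u \<Omega> E \<longrightarrow>
     finite K \<longrightarrow> K \<subseteq> carrier G - E \<longrightarrow> (\<Sum>x\<in>K. max 0 (u x) ^ Suc n) \<le> (b::real)"
proof -
  \<comment> \<open>The exponent is chosen such that \<open>q ^ Suc n\<close> beats the growth rate
    \<open>card S\<close>, so its powers are summable over the group.\<close>
  have "(\<lambda>n. q ^ n) \<longlonglongrightarrow> 0" using q by (intro LIMSEQ_power_zero) auto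
  moreover have "0 < 1 / (2 * (real (card S) + 1))" by simp
  ultimately have "eventually (\<lambda>n. q ^ n < 1 / (2 * (real (card S) + 1))) sequentially"
    by (rule order_tendstoD(2))
  then obtain n where "q ^ n < 1 / (2 * (real (card S) + 1))" by (auto simp: eventually_sequentially)
  moreover have "q ^ Suc n \<le> q ^ n" using q by (simp add: mult_left_le_one_le)
  ultimately have "q ^ Suc n * (2 * (real (card S) + 1)) < 1"
    using pos_less_divide_eq[of "2 * (real (card S) + 1)" "q ^ Suc n" 1] by auto
  then have "2 * (card S * q ^ Suc n) + 2 * q ^ Suc n < 1"
    by (simp add: algebra_simps del: power_Suc)
  moreover have "0 < q ^ Suc n" using q(1) by (rule zero_less_power)
  ultimately have small: "card S * q ^ Suc n \<le> 1 / 2" by linarith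
  \<comment> \<open>Chosen such that the relative gradient term takes up at most half of the
    left-hand side; the summand 1 covers \<open>C = 0\<close>.\<close>
  define K0 where "K0 = 4 * card S * Suc n * C / c + 1"
  have K0: "0 < K0" using c C unfolding K0_def by (intro add_nonneg_pos) auto
  define \<epsilon> where "\<epsilon> = Suc n * C / K0"
  define \<kappa> where "\<kappa> = Suc n * C * K0 ^ n"
  have eps: "2 * card S * \<epsilon> \<le> c / 2"
    using K0 c C unfolding \<epsilon>_def K0_def by (simp add: field_simps)
  have kap: "0 \<le> \<kappa>" "0 \<le> \<epsilon>" using K0 C by (auto simp: \<kappa>_def \<epsilon>_def)
  have "(\<Sum>x\<in>K. max 0 (u x) ^ Suc n) \<le> 8 * card S * \<kappa> / c"
    if slow: "slowly_varying C q u" and md: "minimal_with_data u \<Omega> E"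
      and K: "finite K" "K \<subseteq> carrier G - E" for u \<Omega> E K
  proof -
    have lip: "\<bar>u x - u y\<bar> \<le> C * q ^ len x" if "x \<in> carrier G" "adjacent x y" for x y
      using slow that by (simp add: slowly_varying_def)
    have E: "E \<subseteq> carrier G" and \<Omega>: "finite \<Omega>" "\<Omega> \<subseteq> carrier G" and min: "minimal_in \<Omega> E"
      and data: "\<And>x. x \<in> carrier G - E \<Longrightarrow> 0 < u x \<Longrightarrow> x \<in> inner_part G S \<Omega>"
      using md by (auto simp: minimal_with_data_def)
    define \<phi> where "\<phi> x = max 0 (u x) ^ Suc n" for x
    have \<phi>: "0 \<le> \<phi> x" for x by (simp add: \<phi>_def)
    have \<phi>_pos: "0 < u x" if "0 < \<phi> x" for x using that by (cases "0 < u x") (auto simp: \<phi>_def max_absorb1)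
    define F where "F = {x \<in> carrier G - E. 0 < \<phi> x}"
    have F: "F \<subseteq> inner_part G S \<Omega>" "F \<subseteq> carrier G" "F \<inter> E = {}"
      using data \<phi>_pos by (auto simp: F_def)
    have finF: "finite F" using F(1) \<Omega>(1) inner_part_subset finite_subset by metis
    define Ed where "Ed = (SIGMA p:F. {q. adjacent p q})"
    have finEd: "finite Ed" using finF by (simp add: Ed_def)
    define N where "N = {pq \<in> Ed. snd pq \<notin> E}"
    have finN: "finite N" using finEd by (simp add: N_def)
    \<comment> \<open>With \<open>min\<close>, an edge along which \<open>\<phi>\<close> rises
      counts zero, and the number of edges crossing level \<open>t\<close> becomes a difference of
      two indicators, as \<open>layer_cake_le\<close> requires.\<close>
    have level: "c * (\<Sum>x\<in>F. if t < \<phi> x then 1 else 0) \<le>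
        2 * (\<Sum>pq\<in>N. (if t < \<phi> (fst pq) then 1 else 0)
                    - (if t < min (\<phi> (fst pq)) (\<phi> (snd pq)) then 1 else 0))"
      if t: "0 \<le> t" for t
    proof -
      define Ft where "Ft = {x \<in> F. t < \<phi> x}"
      have Ft: "Ft \<subseteq> inner_part G S \<Omega>" "Ft \<inter> E = {}" "finite Ft" "Ft \<subseteq> carrier G"
        using F finF by (auto simp: Ft_def)
      let ?P = "{(p, q). p \<in> Ft \<and> q \<in> E \<and> adjacent p q}"
      let ?Q = "{(p, q). p \<in> Ft \<and> q \<notin> E \<union> Ft \<and> adjacent p q}"
      have PQ: "finite ?P" "finite ?Q"
        by (rule finite_subset[OF _ finEd]; auto simp: Ed_def Ft_def)+
      have "cut_edges Ft = ?P \<union> ?Q" using Ft(2) by (auto simp: cut_edges_def)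
      then have "card (cut_edges Ft) = card ?P + card ?Q"
        using PQ by (simp only:) (subst card_Un_disjoint, auto)
      also have "\<dots> \<le> 2 * card ?Q" using minimal_in_union[OF min E \<Omega> Ft(1,2)] by simp
      finally have "c * card Ft \<le> 2 * real (card ?Q)" using iso[OF Ft(3,4)] by simp
      moreover have "(\<Sum>x\<in>F. if t < \<phi> x then 1 else 0) = real (card Ft)"
        using finF by (simp add: Ft_def flip: sum.inter_filter)
      moreover have "real (card ?Q) = (\<Sum>pq\<in>N. (if t < \<phi> (fst pq) then 1 else 0)
                    - (if t < min (\<phi> (fst pq)) (\<phi> (snd pq)) then 1 else 0))"
      proof -
        \<comment> \<open>A point outside \<open>E\<close> with \<open>\<phi>\<close> above
          \<open>t \<ge> 0\<close> lies in \<open>F\<close>, so outside \<open>E\<close> not being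
          in \<open>Ft\<close> means \<open>\<phi> \<le> t\<close>.\<close>
        have "?Q = {pq \<in> N. t < \<phi> (fst pq) \<and> \<not> t < \<phi> (snd pq)}"
          using t F(2) adjacent_closed by (auto simp: N_def Ed_def Ft_def F_def)
        then have "real (card ?Q) = (\<Sum>pq\<in>N. if t < \<phi> (fst pq) \<and> \<not> t < \<phi> (snd pq) then 1 else 0)"
          using finN by (simp flip: sum.inter_filter)
        also have "\<dots> = (\<Sum>pq\<in>N. (if t < \<phi> (fst pq) then 1 else 0)
                    - (if t < min (\<phi> (fst pq)) (\<phi> (snd pq)) then 1 else 0))"
          by (intro sum.cong) auto
        finally show ?thesis .
      qed
      ultimately show ?thesis by simp
    qed
    have "c * (\<Sum>x\<in>F. \<phi> x) \<le> 2 * (\<Sum>pq\<in>N. \<phi> (fst pq) - min (\<phi> (fst pq)) (\<phi> (snd pq)))"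
    proof (rule layer_cake_le[OF finF finN])
      fix t :: real assume "0 \<le> t"
      then show "c * (\<Sum>x\<in>F. if t < \<phi> x then 1 else 0) \<le>
        2 * (\<Sum>pq\<in>N. (if t < \<phi> (fst pq) then 1 else 0)
                    - (if t < min (\<phi> (fst pq)) (\<phi> (snd pq)) then 1 else 0))" by (rule level)
    qed (simp_all add: \<phi>)
    also have "\<dots> \<le> 2 * (\<Sum>pq\<in>Ed. \<phi> (fst pq) - min (\<phi> (fst pq)) (\<phi> (snd pq)))"
      using finEd by (intro mult_left_mono sum_mono2) (auto simp: N_def)
    also have "\<dots> \<le> 2 * (\<Sum>pq\<in>Ed. \<epsilon> * \<phi> (fst pq) + \<kappa> * (q ^ Suc n) ^ len (fst pq))"
    proof (intro mult_left_mono sum_mono)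
      fix pq assume "pq \<in> Ed"
      then obtain x y where xy: "pq = (x, y)" "x \<in> carrier G" "adjacent x y"
        using F(2) by (auto simp: Ed_def)
      have bound: "0 \<le> \<epsilon> * \<phi> x + \<kappa> * (q ^ Suc n) ^ len x" using kap \<phi> q by simp
      show "\<phi> (fst pq) - min (\<phi> (fst pq)) (\<phi> (snd pq)) \<le> \<epsilon> * \<phi> (fst pq) + \<kappa> * (q ^ Suc n) ^ len (fst pq)"
      proof (cases "\<phi> x \<le> \<phi> y")
        case True
        then show ?thesis using bound xy by simp
      next
        case False
        then have "max 0 (u y) < max 0 (u x)"
          unfolding \<phi>_def by (meson max.cobounded1 not_le power_mono)
        moreover have "max 0 (u x) - max 0 (u y) \<le> C * q ^ len x"
          using lip[OF xy(2,3)] C q by (auto simp: max_def)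
        ultimately have "\<phi> x - \<phi> y \<le> \<epsilon> * \<phi> x + \<kappa> * (q ^ len x) ^ Suc n"
          unfolding \<phi>_def \<epsilon>_def \<kappa>_def using K0 C q
          by (intro power_diff_split) auto
        moreover have "(q ^ len x) ^ Suc n = (q ^ Suc n) ^ len x"
          by (simp only: mult.commute flip: power_mult)
        ultimately show ?thesis using False xy by simp
      qed
    qed simp
    also have "\<dots> = 2 * (\<Sum>x\<in>F. \<Sum>y\<in>{y. adjacent x y}. \<epsilon> * \<phi> x + \<kappa> * (q ^ Suc n) ^ len x)"
      unfolding Ed_def using finF by (subst sum.Sigma) (auto simp: split_beta)
    also have "\<dots> \<le> 2 * (\<Sum>x\<in>F. card S * (\<epsilon> * \<phi> x + \<kappa> * (q ^ Suc n) ^ len x))"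
    proof (intro mult_left_mono sum_mono)
      fix x
      have "0 \<le> \<epsilon> * \<phi> x + \<kappa> * (q ^ Suc n) ^ len x" using kap \<phi> q by simp
      then show "(\<Sum>y\<in>{y. adjacent x y}. \<epsilon> * \<phi> x + \<kappa> * (q ^ Suc n) ^ len x)
          \<le> card S * (\<epsilon> * \<phi> x + \<kappa> * (q ^ Suc n) ^ len x)"
        using card_adjacent[of x] by (simp only: sum_constant) (intro mult_right_mono, auto)
    qed simp
    also have "\<dots> = 2 * card S * \<epsilon> * (\<Sum>x\<in>F. \<phi> x) + 2 * card S * \<kappa> * (\<Sum>x\<in>F. (q ^ Suc n) ^ len x)"
      by (simp add: sum.distrib distrib_left mult.assoc flip: sum_distrib_left)
    \<comment> \<open>The first term is absorbed into the left-hand side; the second is a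
      constant.\<close>
    also have "\<dots> \<le> c / 2 * (\<Sum>x\<in>F. \<phi> x) + 2 * card S * \<kappa> * 2"
      using eps \<phi> kap finF F(2) q small
      by (intro add_mono mult_right_mono mult_left_mono sum_power_len_le sum_nonneg) auto
    finally have "(\<Sum>x\<in>F. \<phi> x) \<le> 8 * card S * \<kappa> / c" using c by (simp add: field_simps)
    moreover have "(\<Sum>x\<in>K. \<phi> x) \<le> (\<Sum>x\<in>F. \<phi> x)"
    proof -
      have "(\<Sum>x\<in>K. \<phi> x) = (\<Sum>x\<in>K \<inter> F. \<phi> x)"
        using K \<phi> by (intro sum.mono_neutral_right) (auto simp: F_def less_le)
      also have "\<dots> \<le> (\<Sum>x\<in>F. \<phi> x)" using finF \<phi> by (intro sum_mono2) auto
      finally show ?thesis .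
    qed
    ultimately show ?thesis by (simp add: \<phi>_def)
  qed
  then show ?thesis by blast
qed

section \<open>Passage to the limit\<close>

lemma countable_carrier: "countable (carrier G)"
proof -
  have "carrier G = (\<Union>n. len_ball n)" by (auto simp: len_ball_def)
  then show ?thesis by (metis countable_UN countable_finite countableI_type finite_len_ball)
qed

theorem local_minimizer_with_asymptotics:
  assumes c: "0 < c" and iso: "\<And>F. finite F \<Longrightarrow> F \<subseteq> carrier G \<Longrightarrow> c * real (card F) \<le> card (cut_edges F)"
    and q: "0 < q" "q < 1" and C: "0 \<le> C"
    and slow: "slowly_varying C q u"
  shows "\<exists>D\<subseteq>carrier G. (\<forall>\<Omega>. finite \<Omega> \<longrightarrow> \<Omega> \<subseteq> carrier G \<longrightarrow> minimal_in \<Omega> D) \<and>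
    (\<forall>r>0. finite {x \<in> carrier G - D. r \<le> u x} \<and> finite {x \<in> D. u x \<le> - (r::real)})"
proof -
  define A where "A = {x \<in> carrier G. 0 < u x}"
  have "\<forall>n. \<exists>E\<subseteq>carrier G. E \<inter> (carrier G - inner_part G S (len_ball n)) =
      A \<inter> (carrier G - inner_part G S (len_ball n)) \<and> minimal_in (len_ball n) E"
    by (intro allI minimizer_exists) (auto simp: A_def)
  then obtain E where E: "\<And>n. E n \<subseteq> carrier G" "\<And>n. minimal_in (len_ball n) (E n)"
    "\<And>n. E n \<inter> (carrier G - inner_part G S (len_ball n)) = A \<inter> (carrier G - inner_part G S (len_ball n))"
    by metis
  have data: "minimal_with_data u (len_ball n) (E n)" for n
    using E[of n] len_ball_subset by (auto simp: minimal_with_data_def A_def)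
  \<comment> \<open>Replacing \<open>u\<close> by \<open>- u\<close> and sets by complements
    exchanges the two sides, so one energy bound serves both.\<close>
  have data': "minimal_with_data (\<lambda>x. - u x) (len_ball n) (carrier G - E n)" for n
    unfolding minimal_with_data_def
  proof (intro conjI ballI impI)
    fix x assume x: "x \<in> carrier G - (carrier G - E n)" "0 < - u x"
    show "x \<in> inner_part G S (len_ball n)"
    proof (rule ccontr)
      assume "x \<notin> inner_part G S (len_ball n)"
      then have "x \<in> A" using x(1) E(3)[of n] by blast
      then show False using x(2) by (simp add: A_def)
    qed
  qed (use E len_ball_subset minimal_in_compl in auto)
  have slow': "slowly_varying C q (\<lambda>x. - u x)"
    using slow by (simp add: slowly_varying_def abs_minus_commute)
  obtain m and b :: real where bound: "\<And>v \<Omega> E K. slowly_varying C q v \<Longrightarrow> minimal_with_data v \<Omega> E \<Longrightarrow>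
      finite K \<Longrightarrow> K \<subseteq> carrier G - E \<Longrightarrow> (\<Sum>x\<in>K. max 0 (v x) ^ Suc m) \<le> b"
    using minimal_energy_bound[OF c iso q C] by blast
  obtain k D where kD: "strict_mono (k::nat \<Rightarrow> nat)" "D \<subseteq> carrier G"
    "\<And>x. x \<in> carrier G \<Longrightarrow> eventually (\<lambda>n. x \<in> E (k n) \<longleftrightarrow> x \<in> D) sequentially"
    using convergent_subsequence_sets[OF countable_carrier, of E] by blast
  have agree: "eventually (\<lambda>n. \<forall>x\<in>K. x \<in> E (k n) \<longleftrightarrow> x \<in> D) sequentially"
    if "finite K" "K \<subseteq> carrier G" for K
    using that kD(3) by (intro eventually_ball_finite) auto
  have "minimal_in \<Omega> D" if \<Omega>: "finite \<Omega>" "\<Omega> \<subseteq> carrier G" for \<Omega>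
  proof -
    define N where "N = Max (insert 0 (len ` \<Omega>))"
    have "\<Omega> \<subseteq> len_ball n" if "N \<le> n" for n
    proof
      fix x assume x: "x \<in> \<Omega>"
      then have "len x \<le> N" using \<Omega> by (simp add: N_def)
      then show "x \<in> len_ball n" using x \<Omega> that by (auto simp: len_ball_def)
    qed
    then have "\<Omega> \<subseteq> len_ball (k n)" if "N \<le> n" for n
      using that seq_suble[OF kD(1), of n] by (meson le_trans)
    moreover obtain n where "N \<le> n" "\<forall>x\<in>\<Omega>. x \<in> E (k n) \<longleftrightarrow> x \<in> D"
      using agree[OF \<Omega>] unfolding eventually_sequentially by (meson nle_le)
    ultimately have "minimal_in \<Omega> (E (k n))" "E (k n) \<inter> \<Omega> = D \<inter> \<Omega>"
      using minimal_in_subset[OF E(2)] len_ball_subset finite_len_ball by blast+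
    then show ?thesis using minimal_in_cong E(1) by blast
  qed
  moreover have "finite {x \<in> carrier G - D. r \<le> u x}" if r: "0 < r" for r
  proof -
    have bd: "real (card K) \<le> b / r ^ Suc m" if K: "K \<subseteq> {x \<in> carrier G - D. r \<le> u x}" "finite K" for K
    proof -
      \<comment> \<open>On the finite set \<open>K\<close> some minimiser agrees with the limit, so
        its energy bound applies to \<open>K\<close>.\<close>
      obtain n where n: "\<forall>x\<in>K. x \<in> E (k n) \<longleftrightarrow> x \<in> D"
        using eventually_happens'[OF _ agree[OF K(2)]] K(1) by force
      have "card K * r ^ Suc m = (\<Sum>x\<in>K. r ^ Suc m)" by simp
      also have "\<dots> \<le> (\<Sum>x\<in>K. max 0 (u x) ^ Suc m)"
        using K r by (intro sum_mono power_mono) auto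
      also have "\<dots> \<le> b"
        using K n by (intro bound[OF slow data]) auto
      finally show ?thesis using r by (simp add: field_simps)
    qed
    have "card K \<le> nat \<lceil>b / r ^ Suc m\<rceil>" if "K \<subseteq> {x \<in> carrier G - D. r \<le> u x}" "finite K" for K
      using bd[OF that] real_nat_ceiling_ge[of "b / r ^ Suc m"] by linarith
    then show ?thesis using finite_if_finite_subsets_card_bdd by blast
  qed
  moreover have "finite {x \<in> D. u x \<le> - r}" if r: "0 < r" for r
  proof -
    have bd: "real (card K) \<le> b / r ^ Suc m" if K: "K \<subseteq> {x \<in> D. u x \<le> - r}" "finite K" for K
    proof -
      obtain n where n: "\<forall>x\<in>K. x \<in> E (k n) \<longleftrightarrow> x \<in> D"
        using eventually_happens'[OF _ agree[OF K(2)]] K(1) kD(2) by force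
      have "card K * r ^ Suc m = (\<Sum>x\<in>K. r ^ Suc m)" by simp
      also have "\<dots> \<le> (\<Sum>x\<in>K. max 0 (- u x) ^ Suc m)"
        using K r by (intro sum_mono power_mono) auto
      also have "\<dots> \<le> b"
        using K n kD(2) by (intro bound[OF slow' data']) auto
      finally show ?thesis using r by (simp add: field_simps)
    qed
    have "card K \<le> nat \<lceil>b / r ^ Suc m\<rceil>" if "K \<subseteq> {x \<in> D. u x \<le> - r}" "finite K" for K
      using bd[OF that] real_nat_ceiling_ge[of "b / r ^ Suc m"] by linarith
    then show ?thesis using finite_if_finite_subsets_card_bdd by blast
  qed
  ultimately show ?thesis using kD(2) by blast
qed

end

section \<open>Visual metrics\<close>

text \<open>The distance to a nonempty set is 1-Lipschitz.\<close>

lemma (in Metric_space) INF_dist_le: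
  assumes P: "P \<noteq> {}" "P \<subseteq> M" and x: "x \<in> M" and y: "y \<in> M"
  shows "(INF z\<in>P. d x z) \<le> d x y + (INF z\<in>P. d y z)"
proof -
  have bdd: "bdd_below ((\<lambda>z. d x z) ` P)" by (rule bdd_belowI2[of _ 0]) simp
  have "(INF z\<in>P. d x z) - d x y \<le> (INF z\<in>P. d y z)"
  proof (rule cINF_greatest[OF P(1)])
    fix z assume z: "z \<in> P"
    have "(INF z\<in>P. d x z) \<le> d x z" using bdd z by (rule cINF_lower)
    also have "\<dots> \<le> d x y + d y z" using triangle x y z P by blast
    finally show "(INF z\<in>P. d x z) - d x y \<le> d y z" by simp
  qed
  then show ?thesis by simp
qed

lemma (in hyperbolic_word_group) infinite_axial_powers:
  assumes "axial g" shows "infinite (range (\<lambda>n::nat. g [^] n))"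
proof
  assume fin: "finite (range (\<lambda>n::nat. g [^] n))"
  define \<kappa> where "\<kappa> = len g - 2 * gp \<one> g (inv g) - 2 * \<delta>"
  have \<kappa>: "0 < \<kappa>" using assms delta_nonneg by (simp add: axial_def \<kappa>_def)
  define N where "N = Max (len ` range (\<lambda>n::nat. g [^] n))"
  obtain n :: nat where n: "N < n * \<kappa>" using reals_Archimedean3[OF \<kappa>] by blast
  have "len (g [^] n) \<le> N" using fin unfolding N_def by (intro Max_ge) auto
  then show False using axial_len_pow[OF assms, of n] n by (simp add: \<kappa>_def)
qed

lemma (in hyperbolic_word_group) axial_pow_neq_one:
  assumes "axial g" "0 < n" shows "g [^] (n::nat) \<noteq> \<one>"
proof
  assume "g [^] n = \<one>"
  moreover have "0 < len g - 2 * gp \<one> g (inv g) - 2 * \<delta>"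
    using assms delta_nonneg by (simp add: axial_def)
  ultimately show False
    using axial_len_pow[OF assms(1), of n] assms(2) zero_less_mult_iff[of "real n"]
    by (metis len_one not_le of_nat_0 of_nat_0_less_iff)
qed

section \<open>Minimisers for a pair of sets in the compactification\<close>

locale visual_hyperbolic_group = hyperbolic_word_group +
  fixes \<rho> :: "'a + (nat \<Rightarrow> 'a) set \<Rightarrow> 'a + (nat \<Rightarrow> 'a) set \<Rightarrow> real"
  assumes visual: "visual_metric G S \<rho>"
begin

sublocale compact: Metric_space "compactification G S" \<rho>
  using visual by (simp add: visual_metric_def)

lemma Inl_in_compactification [simp]: "Inl x \<in> compactification G S \<longleftrightarrow> x \<in> carrier G"
  and Inr_in_compactification [simp]: "Inr \<xi> \<in> compactification G S \<longleftrightarrow> \<xi> \<in> boundary G S"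
  by (auto simp: compactification_def)

sublocale bdry: Metric_space "boundary G S" "\<lambda>\<xi> \<eta>. \<rho> (Inr \<xi>) (Inr \<eta>)"
proof
  fix \<xi> \<eta> \<zeta> assume "\<xi> \<in> boundary G S" "\<eta> \<in> boundary G S" "\<zeta> \<in> boundary G S"
  then show "\<rho> (Inr \<xi>) (Inr \<zeta>) \<le> \<rho> (Inr \<xi>) (Inr \<eta>) + \<rho> (Inr \<eta>) (Inr \<zeta>)"
    by (intro compact.triangle) auto
qed (auto simp: compact.commute)

lemma ext_gromov_product_Inl: "ext_gromov_product G S (Inl x) (Inl y) = ereal (gp \<one> x y)"
proof -
  have "sequentially \<times>\<^sub>F sequentially \<noteq> (bot :: (nat \<times> nat) filter)"
    by (simp add: prod_filter_eq_bot)
  then show ?thesis by (simp add: ext_gromov_product_def case_prod_unfold Liminf_const)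
qed

text \<open>Neighbours have product at least \<open>len x - 1\<close>, so \<open>q = 1 / a\<close>
  works and the lost unit costs the factor \<open>a\<close>.\<close>

lemma visual_adjacent:
  "\<exists>C q. 0 \<le> C \<and> 0 < q \<and> q < 1 \<and>
     (\<forall>x\<in>carrier G. \<forall>y. adjacent x y \<longrightarrow> \<rho> (Inl x) (Inl y) \<le> C * q ^ len x)"
proof -
  obtain a C where a: "1 < a" "1 \<le> C" and
    vis: "\<And>x y. x \<in> compactification G S \<Longrightarrow> y \<in> compactification G S \<Longrightarrow> x \<noteq> y \<Longrightarrow>
      \<exists>t::real. ext_gromov_product G S x y = ereal t \<and> a powr (- t) / C \<le> \<rho> x y \<and> \<rho> x y \<le> C * a powr (- t)"
    using visual unfolding visual_metric_def by blast
  have "\<rho> (Inl x) (Inl y) \<le> (C * a) * (1 / a) ^ len x" if x: "x \<in> carrier G" and xy: "adjacent x y" for x y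
  proof (cases "x = y")
    \<comment> \<open>The visual estimate concerns distinct points, but a generator may be the
      identity.\<close>
    case True
    then show ?thesis using a x by simp
  next
    case False
    have y: "y \<in> carrier G" using adjacent_closed[OF x xy] .
    have "\<rho> (Inl x) (Inl y) \<le> C * a powr (- gp \<one> x y)"
      using vis[of "Inl x" "Inl y"] x y False by (auto simp: ext_gromov_product_Inl)
    also have "\<dots> \<le> C * a powr (1 - real (len x))"
    proof -
      have "real (len x) \<le> real (len y) + real (dst x y)"
        using dst_triangle[of \<one> y x] x y dst_commute[of x y] by simp
      then have "real (len x) - 1 \<le> gp \<one> x y"
        using dst_gp[OF x y] adjacent_dst[OF x xy] by linarith
      then show ?thesis using a by (intro mult_left_mono powr_mono) auto
    qed
    also have "\<dots> = (C * a) * (1 / a) ^ len x"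
      using a by (simp add: powr_diff powr_realpow power_one_over field_simps)
    finally show ?thesis .
  qed
  then show ?thesis using a by (intro exI[of _ "C * a"] exI[of _ "1 / a"]) auto
qed

text \<open>The function \<open>u\<close> for a general pair of sets, \<open>P\<close> in the role
  of \<open>D\<^sub>1\<close> and \<open>Q\<close> in that of \<open>D\<^sub>0\<close>. The sets may
  contain group elements, which \<open>axial_plateau\<close> needs.\<close>

definition gap :: "('a + (nat \<Rightarrow> 'a) set) set \<Rightarrow> ('a + (nat \<Rightarrow> 'a) set) set \<Rightarrow> 'a \<Rightarrow> real" where
  "gap P Q x = (INF z\<in>P. \<rho> (Inl x) z) - (INF z\<in>Q. \<rho> (Inl x) z)"

lemma gap_swap: "gap Q P x = - gap P Q x"
  by (simp add: gap_def)

text \<open>At such an \<open>x\<close> the distance to \<open>P\<close> is at least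
  \<open>3 * r / 4\<close> and the distance to \<open>Q\<close> at most
  \<open>r / 4\<close>.\<close>

lemma gap_lower:
  assumes P: "P \<noteq> {}" "P \<subseteq> compactification G S" and Q: "z \<in> Q" "z \<in> compactification G S"
    and far: "\<And>w. w \<in> P \<Longrightarrow> r \<le> \<rho> z w" and x: "x \<in> carrier G" and near: "\<rho> (Inl x) z \<le> r / 4"
  shows "r / 2 \<le> gap P Q x"
proof -
  have "3 * r / 4 \<le> (INF w\<in>P. \<rho> (Inl x) w)"
  proof (rule cINF_greatest[OF P(1)])
    fix w assume w: "w \<in> P"
    then have "r \<le> \<rho> z (Inl x) + \<rho> (Inl x) w"
      using far[OF w] compact.triangle[of z "Inl x" w] Q x P by force
    then show "3 * r / 4 \<le> \<rho> (Inl x) w" using near compact.commute[of z "Inl x"] by linarith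
  qed
  moreover have "(INF w\<in>Q. \<rho> (Inl x) w) \<le> \<rho> (Inl x) z"
    by (rule cINF_lower[OF _ Q(1)]) (rule bdd_belowI2[of _ 0], simp)
  ultimately show ?thesis using near by (simp add: gap_def)
qed

lemma minimizer_for_gap:
  assumes ne: "\<not> elementary_group G"
    and P: "P \<noteq> {}" "P \<subseteq> compactification G S" and Q: "Q \<noteq> {}" "Q \<subseteq> compactification G S"
  shows "\<exists>D\<subseteq>carrier G. (\<forall>\<Omega>. finite \<Omega> \<longrightarrow> \<Omega> \<subseteq> carrier G \<longrightarrow> minimal_in \<Omega> D) \<and>
    (\<forall>r>0. finite {x \<in> carrier G - D. r \<le> gap P Q x} \<and> finite {x \<in> D. r \<le> gap Q P x})"
proof -
  obtain c where c: "0 < c"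
    "\<And>F. finite F \<Longrightarrow> F \<subseteq> carrier G \<Longrightarrow> c * real (card F) \<le> card (cut_edges F)"
    using linear_isoperimetric_inequality[OF ne] by blast
  obtain C q where C: "0 \<le> C" "0 < q" "q < 1"
    "\<And>x y. x \<in> carrier G \<Longrightarrow> adjacent x y \<Longrightarrow> \<rho> (Inl x) (Inl y) \<le> C * q ^ len x"
    using visual_adjacent by blast
  \<comment> \<open>Each of the two infima contributes \<open>C * q ^ len x\<close>.\<close>
  have "slowly_varying (2 * C) q (gap P Q)"
    unfolding slowly_varying_def
  proof (intro ballI allI impI)
    fix x y assume x: "x \<in> carrier G" and xy: "adjacent x y"
    have y: "y \<in> carrier G" using adjacent_closed[OF x xy] .
    have m: "Inl x \<in> compactification G S" "Inl y \<in> compactification G S" using x y by auto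
    show "\<bar>gap P Q x - gap P Q y\<bar> \<le> 2 * C * q ^ len x"
      using compact.INF_dist_le[OF P m] compact.INF_dist_le[OF P m(2,1)]
        compact.INF_dist_le[OF Q m] compact.INF_dist_le[OF Q m(2,1)] C(4)[OF x xy]
        compact.commute[of "Inl x" "Inl y"]
      unfolding gap_def by linarith
  qed
  from local_minimizer_with_asymptotics[OF c C(2,3) _ this]
  obtain D where D: "D \<subseteq> carrier G" "\<forall>\<Omega>. finite \<Omega> \<longrightarrow> \<Omega> \<subseteq> carrier G \<longrightarrow> minimal_in \<Omega> D"
    "\<forall>r>0. finite {x \<in> carrier G - D. r \<le> gap P Q x} \<and> finite {x \<in> D. gap P Q x \<le> - r}"
    using C(1) by auto
  then show ?thesis by (intro exI[of _ D]) (simp add: gap_swap[of Q P] le_minus_iff)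
qed

text \<open>If a step changes membership in \<open>D\<close>, its starting vertex lies in the outer
  boundary of the side that it enters.\<close>

lemma crossing_path:
  assumes path: "\<And>i::int. p i \<in> carrier G" "\<And>i. \<exists>s\<in>S. p (i + 1) = p i \<otimes> s"
    and D: "D \<subseteq> carrier G"
    and avoid: "range p \<inter> (outer_boundary G S D \<union> outer_boundary G S (carrier G - D)) = {}"
  shows "range p \<subseteq> D \<or> range p \<subseteq> carrier G - D"
proof -
  have step: "p (i + 1) \<in> D \<longleftrightarrow> p i \<in> D" for i
  proof (rule ccontr)
    assume neq: "(p (i + 1) \<in> D) \<noteq> (p i \<in> D)"
    obtain s where s: "s \<in> S" "p (i + 1) = p i \<otimes> s" using path(2) by blast
    then have "p i \<in> outer_boundary G S D \<union> outer_boundary G S (carrier G - D)"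
      using neq path(1)[of i] path(1)[of "i + 1"]
      by (cases "p i \<in> D") (auto simp: outer_boundary_def)
    then show False using avoid by blast
  qed
  have "p i \<in> D \<longleftrightarrow> p 0 \<in> D" for i
  proof (induction i rule: int_induct[where k=0])
    case (step1 i) then show ?case using step by simp
  next
    case (step2 i) then show ?case using step[of "i - 1"] by simp
  qed simp
  then show ?thesis using path(1) by blast
qed

text \<open>Since the Cayley graph is connected, a nontrivial \<open>D\<close> has a boundary edge,
  so the solution is nonempty. Condition (i) reduces to no path staying on one side.\<close>

lemma solves_from_minimizer:
  fixes D\<^sub>0 :: "(nat \<Rightarrow> 'a) set set"
  defines "X \<equiv> boundary_topology G S \<rho>"
  assumes D: "D \<subseteq> carrier G" and nontrivial: "D \<noteq> {}" "D \<noteq> carrier G"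
    and min: "\<And>\<Omega>. finite \<Omega> \<Longrightarrow> \<Omega> \<subseteq> carrier G \<Longrightarrow> minimal_in \<Omega> D"
    and path: "\<And>\<xi> \<eta> p. \<lbrakk>\<xi> \<in> X interior_of D\<^sub>0;
      \<eta> \<in> X interior_of (X closure_of (boundary G S - D\<^sub>0)); path_between G S \<rho> \<xi> \<eta> p\<rbrakk> \<Longrightarrow>
      \<not> range p \<subseteq> D \<and> \<not> range p \<subseteq> carrier G - D"
  shows "solves_asymptotic_plateau G S \<rho> D\<^sub>0
    (outer_boundary G S D \<union> outer_boundary G S (carrier G - D))"
proof -
  obtain x y where xy: "x \<in> D" "y \<in> carrier G" "y \<notin> D" using D nontrivial by blast
  then have "inv x \<otimes> y \<in> carrier G" "x \<otimes> (inv x \<otimes> y) \<notin> D" using D by (auto simp: mult_inv_cancel)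
  then obtain p q where pq: "p \<in> D" "q \<notin> D" "adjacent p q" using exit_edge[OF xy(1) D] by blast
  then have "q \<in> carrier G" "adjacent q p" using D adjacent_closed adjacent_sym by blast+
  then have "q \<in> outer_boundary G S D" using pq by (auto simp: outer_boundary_def adjacent_def)
  then have ne: "outer_boundary G S D \<union> outer_boundary G S (carrier G - D) \<noteq> {}" by blast
  have minimal: "boundary_size G S \<Omega> D \<le> boundary_size G S \<Omega> B \<and>
      boundary_size G S \<Omega> (carrier G - D) \<le> boundary_size G S \<Omega> B"
    if "finite \<Omega>" "\<Omega> \<subseteq> carrier G" "B \<subseteq> carrier G"
      "B \<inter> (carrier G - inner_part G S \<Omega>) = D \<inter> (carrier G - inner_part G S \<Omega>)" for \<Omega> B
    using min[OF that(1,2)] that boundary_size_compl[OF that(2), of D]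
    unfolding minimal_in_def by auto
  have cross: "range p \<inter> (outer_boundary G S D \<union> outer_boundary G S (carrier G - D)) \<noteq> {}"
    if "\<xi> \<in> X interior_of D\<^sub>0" "\<eta> \<in> X interior_of (X closure_of (boundary G S - D\<^sub>0))"
      "path_between G S \<rho> \<xi> \<eta> p" for \<xi> \<eta> p
    using path[OF that] crossing_path[of p D] that(3) D unfolding path_between_def by blast
  show ?thesis
    unfolding solves_asymptotic_plateau_def Let_def X_def[symmetric]
  proof (intro conjI ne)
    show "outer_boundary G S D \<union> outer_boundary G S (carrier G - D) \<subseteq> carrier G"
      by (auto simp: outer_boundary_def)
  qed (rule exI[of _ D], rule exI[of _ "carrier G - D"], use D cross minimal in auto)
qed

text \<open>Needed when the interior of \<open>D\<^sub>0\<close> or \<open>D\<^sub>1\<close> is empty: condition (i) is then void, but the solution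
  must still be nonempty. The ends of an axial element take the place of \<open>D\<^sub>0\<close> and \<open>D\<^sub>1\<close>.\<close>

lemma axial_plateau:
  assumes ne: "\<not> elementary_group G"
  shows "\<exists>D\<subseteq>carrier G. D \<noteq> {} \<and> D \<noteq> carrier G \<and>
    (\<forall>\<Omega>. finite \<Omega> \<longrightarrow> \<Omega> \<subseteq> carrier G \<longrightarrow> minimal_in \<Omega> D)"
proof -
  obtain g where g: "axial g" using axial_exists infinite_of_not_elementary[OF ne] by blast
  then have gc: "g \<in> carrier G" by (simp add: axial_def)
  \<comment> \<open>\<open>Suc n\<close> leaves out the identity, which would lie in both
    half-orbits.\<close>
  define P where "P h = (\<lambda>n::nat. Inl (h [^] Suc n) :: 'a + (nat \<Rightarrow> 'a) set) ` UNIV" for h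
  obtain a C where a: "1 < a" "1 \<le> C" and
    vis: "\<And>x y. x \<in> compactification G S \<Longrightarrow> y \<in> compactification G S \<Longrightarrow> x \<noteq> y \<Longrightarrow>
      \<exists>t::real. ext_gromov_product G S x y = ereal t \<and> a powr (- t) / C \<le> \<rho> x y \<and> \<rho> x y \<le> C * a powr (- t)"
    using visual unfolding visual_metric_def by blast
  \<comment> \<open>A uniform separation of the half-orbits: the lower visual estimate at the bound
    of \<open>axial_two_sided\<close>.\<close>
  define r where "r = a powr (- (gp \<one> g (inv g) + 2 * \<delta>)) / C"
  have r: "0 < r" using a by (simp add: r_def)
  have far: "r \<le> \<rho> (Inl (g [^] Suc n)) (Inl (inv g [^] Suc k))" for n k
  proof -
    let ?x = "g [^] Suc n" and ?y = "inv g [^] Suc k"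
    have "?x \<noteq> ?y"
    proof
      assume "?x = ?y"
      then have "?x \<otimes> g [^] Suc k = inv (g [^] Suc k) \<otimes> g [^] Suc k"
        using nat_pow_inv[OF gc, of "Suc k"] by simp
      then have "g [^] (Suc n + Suc k) = \<one>" using gc nat_pow_mult[OF gc] by (metis l_inv nat_pow_closed)
      then show False using axial_pow_neq_one[OF g, of "Suc n + Suc k"] by simp
    qed
    then have "a powr (- gp \<one> ?x ?y) / C \<le> \<rho> (Inl ?x) (Inl ?y)"
      using vis[of "Inl ?x" "Inl ?y"] gc by (auto simp: ext_gromov_product_Inl simp del: nat_pow_Suc)
    moreover have "r \<le> a powr (- gp \<one> ?x ?y) / C"
      unfolding r_def using a axial_two_sided[OF g, of "Suc n" "Suc k"]
      by (intro divide_right_mono powr_mono) (auto simp del: nat_pow_Suc)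
    ultimately show ?thesis by linarith
  qed
  have P: "P h \<noteq> {}" "P h \<subseteq> compactification G S" if "h \<in> carrier G" for h
    using that by (auto simp: P_def simp del: nat_pow_Suc)
  have ginv: "inv g \<in> carrier G" using gc by simp
  obtain D where D: "D \<subseteq> carrier G"
      "\<forall>\<Omega>. finite \<Omega> \<longrightarrow> \<Omega> \<subseteq> carrier G \<longrightarrow> minimal_in \<Omega> D"
    and fin: "\<forall>r>0. finite {x \<in> carrier G - D. r \<le> gap (P (inv g)) (P g) x} \<and>
      finite {x \<in> D. r \<le> gap (P g) (P (inv g)) x}"
    using minimizer_for_gap[OF ne P[OF ginv] P[OF gc]] by blast
  have fin1: "finite {x \<in> carrier G - D. r / 2 \<le> gap (P (inv g)) (P g) x}"
    and fin2: "finite {x \<in> D. r / 2 \<le> gap (P g) (P (inv g)) x}"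
    using fin[rule_format, of "r / 2"] r by auto
  have big: "r / 2 \<le> gap (P h') (P h) (h [^] Suc n)"
    if h: "h \<in> carrier G" "h' \<in> carrier G"
      and sep: "\<And>n k. r \<le> \<rho> (Inl (h [^] Suc n)) (Inl (h' [^] Suc k))" for h h' n
  proof (rule gap_lower[where z="Inl (h [^] Suc n)", OF P[OF h(2)]])
    show "Inl (h [^] Suc n) \<in> P h" unfolding P_def by (rule rangeI)
    show "h [^] Suc n \<in> carrier G" "Inl (h [^] Suc n) \<in> compactification G S"
      using h(1) nat_pow_closed[of h "Suc n"] by (simp_all del: nat_pow_Suc)
    then show "\<rho> (Inl (h [^] Suc n)) (Inl (h [^] Suc n)) \<le> r / 4"
      using r compact.zero by simp
  qed (use sep in \<open>auto simp: P_def simp del: nat_pow_Suc\<close>)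
  have inf: "infinite (range (\<lambda>n. h [^] Suc n))" if "axial h" for h
  proof -
    have "range (\<lambda>n::nat. h [^] n) \<subseteq> insert (h [^] (0::nat)) (range (\<lambda>n. h [^] Suc n))"
    proof (rule image_subsetI)
      fix n :: nat
      show "h [^] n \<in> insert (h [^] (0::nat)) (range (\<lambda>n. h [^] Suc n))"
      proof (cases n)
        case 0
        show ?thesis unfolding 0 by (rule insertI1)
      next
        case (Suc m)
        show ?thesis unfolding Suc by (rule insertI2) (rule rangeI)
      qed
    qed
    then show ?thesis using infinite_axial_powers[OF that] finite_subset finite_insert by metis
  qed
  have "D \<noteq> {}"
  proof
    assume "D = {}"
    then have "range (\<lambda>n. g [^] Suc n) \<subseteq> {x \<in> carrier G - D. r / 2 \<le> gap (P (inv g)) (P g) x}"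
      using big[OF gc ginv far] nat_pow_closed[OF gc] by blast
    then show False using inf[OF g] fin1 finite_subset by blast
  qed
  moreover have "D \<noteq> carrier G"
  proof
    have far': "r \<le> \<rho> (Inl (inv g [^] Suc n)) (Inl (g [^] Suc k))" for n k
      using far[of k n] compact.commute[of "Inl (g [^] Suc k)"] by (simp del: nat_pow_Suc)
    assume "D = carrier G"
    then have "range (\<lambda>n. inv g [^] Suc n) \<subseteq> {x \<in> D. r / 2 \<le> gap (P g) (P (inv g)) x}"
      using big[OF ginv gc far'] nat_pow_closed[OF ginv] by blast
    then show False using inf[OF axial_inv[OF g]] fin2 finite_subset by blast
  qed
  ultimately show ?thesis using D by blast
qed

section \<open>Convergence to boundary points\<close>

definition tends_to :: "(nat \<Rightarrow> 'a) \<Rightarrow> (nat \<Rightarrow> 'a) set \<Rightarrow> bool" where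
  "tends_to x \<xi> \<longleftrightarrow> (\<forall>n. x n \<in> carrier G) \<and> (\<forall>\<epsilon>>0. \<exists>N. \<forall>n\<ge>N. \<rho> (Inl (x n)) (Inr \<xi>) < \<epsilon>)"

lemma tends_to_limitin:
  assumes "\<And>n. x n \<in> carrier G"
    and "limitin (compactification_topology G S \<rho>) (\<lambda>n. Inl (x n)) (Inr \<xi>) sequentially"
  shows "tends_to x \<xi>"
  using assms by (auto simp: tends_to_def compactification_topology_def compact.limit_metric_sequentially)

text \<open>Finitely many group elements have a positive minimal distance from a boundary
  point.\<close>

lemma tends_to_not_in_finite:
  assumes lim: "tends_to x \<xi>" and \<xi>: "\<xi> \<in> boundary G S" and K: "finite K"
  shows "\<not> (\<forall>n\<ge>N. x n \<in> K)"
proof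
  assume in_K: "\<forall>n\<ge>N. x n \<in> K"
  define L where "L = K \<inter> carrier G"
  have L: "finite L" "x N \<in> L" using K in_K lim by (auto simp: L_def tends_to_def)
  define \<epsilon> where "\<epsilon> = Min ((\<lambda>y. \<rho> (Inl y) (Inr \<xi>)) ` L)"
  have "0 < \<rho> (Inl y) (Inr \<xi>)" if "y \<in> L" for y
    using that \<xi> compact.mdist_pos_less[of "Inl y" "Inr \<xi>"] by (auto simp: L_def)
  then have "0 < \<epsilon>" using L unfolding \<epsilon>_def by (subst Min_gr_iff) auto
  then obtain M where M: "\<And>n. M \<le> n \<Longrightarrow> \<rho> (Inl (x n)) (Inr \<xi>) < \<epsilon>"
    using lim unfolding tends_to_def by blast
  have "x (max M N) \<in> L" using in_K lim by (auto simp: L_def tends_to_def)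
  then have "\<epsilon> \<le> \<rho> (Inl (x (max M N))) (Inr \<xi>)" using L by (auto simp: \<epsilon>_def)
  then show False using M[of "max M N"] by simp
qed

text \<open>Near \<open>\<xi>\<close> the gap is at least \<open>r / 2\<close>, so a sequence inside
  \<open>E\<close> would have its tail in a finite set.\<close>

lemma tends_to_leaves:
  assumes lim: "tends_to x \<xi>" and \<xi>: "\<xi> \<in> boundary G S" "Inr \<xi> \<in> Q"
    and P: "P \<noteq> {}" "P \<subseteq> compactification G S"
    and r: "0 < r" "\<And>w. w \<in> P \<Longrightarrow> r \<le> \<rho> (Inr \<xi>) w"
    and fin: "finite {y \<in> E. r / 2 \<le> gap P Q y}"
  shows "\<not> range x \<subseteq> E"
proof
  assume E: "range x \<subseteq> E"
  have "0 < r / 4" using r by simp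
  then obtain N where N: "\<And>n. N \<le> n \<Longrightarrow> \<rho> (Inl (x n)) (Inr \<xi>) < r / 4"
    using lim unfolding tends_to_def by blast
  have "x n \<in> {y \<in> E. r / 2 \<le> gap P Q y}" if "N \<le> n" for n
    using gap_lower[OF P \<xi>(2) _ r(2), of "x n"] N[OF that] E lim \<xi>(1) by (auto simp: tends_to_def)
  then show False using tends_to_not_in_finite[OF lim \<xi>(1) fin, of N] by blast
qed

text \<open>Along a geodesic ray representing \<open>\<xi>\<close>, the products of
  \<open>x n\<close> with later points are at least \<open>n\<close> minus a constant. As the
  extended product is a supremum over representatives, this one ray bounds it from below.\<close>

lemma ray_tends_to:
  assumes \<xi>: "\<xi> \<in> boundary G S"
  shows "\<exists>x. tends_to x \<xi>"
proof -
  obtain x where x: "x \<in> geodesic_rays G S" "\<xi> = asymptotic_rel G S `` {x}"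
    using \<xi> by (auto simp: boundary_def quotient_def)
  have xc: "x n \<in> carrier G" for n using x by (simp add: geodesic_rays_def)
  have dist: "dst (x m) (x n) = n - m" if "m \<le> n" for m n using x that by (simp add: geodesic_rays_def)
  have "(x, x) \<in> asymptotic_rel G S" using x(1) xc by (auto simp: asymptotic_rel_def)
  then have x\<xi>: "x \<in> \<xi>" using x(2) by blast
  obtain a C where a: "1 < a" "1 \<le> C" and
    vis: "\<And>x y. x \<in> compactification G S \<Longrightarrow> y \<in> compactification G S \<Longrightarrow> x \<noteq> y \<Longrightarrow>
      \<exists>t::real. ext_gromov_product G S x y = ereal t \<and> a powr (- t) / C \<le> \<rho> x y \<and> \<rho> x y \<le> C * a powr (- t)"
    using visual unfolding visual_metric_def by blast
  define b where "b = real (len (x 0))"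
  have bound: "\<rho> (Inl (x n)) (Inr \<xi>) \<le> (C * a powr b) * (1 / a) ^ n" for n
  proof -
    have gpb: "real n - b \<le> gp \<one> (x n) (x k)" if "n \<le> k" for k
    proof -
      have "real n \<le> b + len (x n)" "real k \<le> b + len (x k)"
        using dst_triangle[of "x 0" \<one> "x n"] dst_triangle[of "x 0" \<one> "x k"] xc
          dst_commute[of "x 0" \<one>] dist[of 0 n] dist[of 0 k] by (auto simp: b_def)
      then show ?thesis using dst_gp[OF xc[of n] xc[of k]] dist[OF that] that by (simp add: of_nat_diff)
    qed
    have "ereal (real n - b) \<le> Liminf (sequentially \<times>\<^sub>F sequentially)
        (\<lambda>(m, k). ereal (gp \<one> (x n) (x k)))"
      using gpb by (intro Liminf_bounded) (auto simp: eventually_prod_sequentially intro!: exI[of _ n])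
    also have "\<dots> \<le> ext_gromov_product G S (Inl (x n)) (Inr \<xi>)"
      unfolding ext_gromov_product_def
      by (rule SUP_upper2[of "(\<lambda>_. x n, x)"]) (auto simp: x\<xi>)
    finally have ext: "ereal (real n - b) \<le> ext_gromov_product G S (Inl (x n)) (Inr \<xi>)" .
    obtain t where t: "ext_gromov_product G S (Inl (x n)) (Inr \<xi>) = ereal t"
      "\<rho> (Inl (x n)) (Inr \<xi>) \<le> C * a powr (- t)"
      using vis[of "Inl (x n)" "Inr \<xi>"] xc \<xi> by auto
    note t(2)
    also have "C * a powr (- t) \<le> C * a powr (b - real n)"
      using ext t(1) a by (intro mult_left_mono powr_mono) auto
    also have "\<dots> = (C * a powr b) * (1 / a) ^ n"
      using a by (simp add: powr_diff powr_realpow power_one_over field_simps)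
    finally show ?thesis .
  qed
  have "(\<lambda>n. (C * a powr b) * (1 / a) ^ n) \<longlonglongrightarrow> (C * a powr b) * 0"
    using a by (intro tendsto_mult tendsto_const LIMSEQ_power_zero) auto
  then have "\<exists>N. \<forall>n\<ge>N. (C * a powr b) * (1 / a) ^ n < \<epsilon>" if "0 < \<epsilon>" for \<epsilon>
    using that by (auto dest!: order_tendstoD(2)[where a=\<epsilon>] simp: eventually_sequentially)
  then have "tends_to x \<xi>" unfolding tends_to_def using bound xc by (meson order_le_less_trans)
  then show ?thesis by blast
qed

lemma interior_far:
  assumes U: "\<xi> \<in> bdry.mtopology interior_of U" and disj: "bdry.mtopology interior_of U \<inter> V = {}"
    and V: "V \<subseteq> boundary G S"
  shows "\<exists>r>0. \<forall>\<zeta>\<in>V. r \<le> \<rho> (Inr \<xi>) (Inr \<zeta>)"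
proof -
  have "openin bdry.mtopology (bdry.mtopology interior_of U)" by simp
  then obtain r where r: "0 < r" "bdry.mball \<xi> r \<subseteq> bdry.mtopology interior_of U"
    "bdry.mtopology interior_of U \<subseteq> boundary G S"
    using U unfolding bdry.openin_mtopology by blast
  have "r \<le> \<rho> (Inr \<xi>) (Inr \<zeta>)" if "\<zeta> \<in> V" for \<zeta>
  proof (rule ccontr)
    assume "\<not> r \<le> \<rho> (Inr \<xi>) (Inr \<zeta>)"
    then have "\<zeta> \<in> bdry.mball \<xi> r" using that V U r(3) by (auto simp: bdry.in_mball)
    then show False using r disj that by blast
  qed
  then show ?thesis using r by blast
qed

section \<open>Existence of solutions\<close>

theorem plateau_solution:
  assumes ne: "\<not> elementary_group G" and D0: "D\<^sub>0 \<subseteq> boundary G S"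
    and reg: "boundary_topology G S \<rho> closure_of (boundary_topology G S \<rho> interior_of D\<^sub>0) = D\<^sub>0"
  shows "\<exists>T. solves_asymptotic_plateau G S \<rho> D\<^sub>0 T"
proof -
  let ?X = "boundary_topology G S \<rho>"
  have X: "?X = bdry.mtopology" by (simp add: boundary_topology_def)
  define D1 where "D1 = ?X closure_of (boundary G S - D\<^sub>0)"
  have D1: "D1 \<subseteq> boundary G S"
    using closure_of_subset_topspace[of bdry.mtopology] by (simp add: D1_def X)
  show ?thesis
  \<comment> \<open>With an empty interior there is no path to test, and any nontrivial minimal set
    will do.\<close>
  proof (cases "?X interior_of D\<^sub>0 = {} \<or> ?X interior_of D1 = {}")
    case True
    obtain D where "D \<subseteq> carrier G" "D \<noteq> {}" "D \<noteq> carrier G"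
      "\<forall>\<Omega>. finite \<Omega> \<longrightarrow> \<Omega> \<subseteq> carrier G \<longrightarrow> minimal_in \<Omega> D"
      using axial_plateau[OF ne] by blast
    then have "solves_asymptotic_plateau G S \<rho> D\<^sub>0
      (outer_boundary G S D \<union> outer_boundary G S (carrier G - D))"
      using True by (intro solves_from_minimizer) (auto simp: D1_def)
    then show ?thesis by blast
  next
    case False
    have sub: "?X interior_of D\<^sub>0 \<subseteq> D\<^sub>0" "?X interior_of D1 \<subseteq> D1" by (auto simp: interior_of_subset)
    \<comment> \<open>The interior is open and misses the complement of \<open>D\<^sub>0\<close>,
      hence also the closure of that complement.\<close>
    have disj: "?X interior_of D\<^sub>0 \<inter> D1 = {}"
      unfolding D1_def by (subst openin_Int_closure_of_eq_empty) (use sub in auto)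
    have "?X interior_of D1 \<inter> ?X interior_of D\<^sub>0 = {}" using disj sub by blast
    \<comment> \<open>Here the regularity of \<open>D\<^sub>0\<close> enters: the interior of
      \<open>D1\<close> misses the interior of \<open>D\<^sub>0\<close>, hence its closure, which is
      \<open>D\<^sub>0\<close>.\<close>
    then have disj': "?X interior_of D1 \<inter> D\<^sub>0 = {}"
      by (subst reg[symmetric], subst openin_Int_closure_of_eq_empty) auto
    define P0 P1 where "P0 = (Inr ` D\<^sub>0 :: ('a + (nat \<Rightarrow> 'a) set) set)"
      and "P1 = (Inr ` D1 :: ('a + (nat \<Rightarrow> 'a) set) set)"
    have P0: "P0 \<noteq> {}" "P0 \<subseteq> compactification G S" using False sub D0 by (auto simp: P0_def)
    have P1: "P1 \<noteq> {}" "P1 \<subseteq> compactification G S" using False sub D1 by (auto simp: P1_def)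
    obtain D where D: "D \<subseteq> carrier G" "\<forall>\<Omega>. finite \<Omega> \<longrightarrow> \<Omega> \<subseteq> carrier G \<longrightarrow> minimal_in \<Omega> D"
      and fin: "\<forall>r>0. finite {x \<in> carrier G - D. r \<le> gap P1 P0 x} \<and> finite {x \<in> D. r \<le> gap P0 P1 x}"
      using minimizer_for_gap[OF ne P1 P0] by blast
    have leave0: "\<not> range x \<subseteq> carrier G - D" if \<xi>: "\<xi> \<in> ?X interior_of D\<^sub>0" and lim: "tends_to x \<xi>" for \<xi> x
    proof -
      obtain r where "0 < r" "\<forall>\<zeta>\<in>D1. r \<le> \<rho> (Inr \<xi>) (Inr \<zeta>)"
        using interior_far[of \<xi> D\<^sub>0 D1] \<xi> disj D1 X by auto
      then show ?thesis
        using sub \<xi> D0 P1 fin[rule_format, of "r / 2"]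
        by (intro tends_to_leaves[OF lim, of P0 P1 r]) (auto simp: P0_def P1_def)
    qed
    have leave1: "\<not> range x \<subseteq> D" if \<eta>: "\<eta> \<in> ?X interior_of D1" and lim: "tends_to x \<eta>" for \<eta> x
    proof -
      obtain r where "0 < r" "\<forall>\<zeta>\<in>D\<^sub>0. r \<le> \<rho> (Inr \<eta>) (Inr \<zeta>)"
        using interior_far[of \<eta> D1 D\<^sub>0] \<eta> disj' D0 X by auto
      then show ?thesis
        using sub \<eta> D1 P0 fin[rule_format, of "r / 2"]
        by (intro tends_to_leaves[OF lim, of P1 P0 r]) (auto simp: P0_def P1_def)
    qed
    have "solves_asymptotic_plateau G S \<rho> D\<^sub>0
      (outer_boundary G S D \<union> outer_boundary G S (carrier G - D))"
    proof (rule solves_from_minimizer[OF D(1)])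
      obtain \<xi> where \<xi>: "\<xi> \<in> ?X interior_of D\<^sub>0" using False by blast
      \<comment> \<open>A sequence of group elements converging to an interior point cannot stay in
        the complement, so \<open>D\<close> is nonempty.\<close>
      obtain x where x: "tends_to x \<xi>" using ray_tends_to[of \<xi>] \<xi> sub D0 by blast
      show "D \<noteq> {}" using leave0[OF \<xi> x] x by (auto simp: tends_to_def)
      obtain \<eta> where \<eta>: "\<eta> \<in> ?X interior_of D1" using False by blast
      obtain y where y: "tends_to y \<eta>" using ray_tends_to[of \<eta>] \<eta> sub D1 by blast
      show "D \<noteq> carrier G" using leave1[OF \<eta> y] y by (auto simp: tends_to_def)
    next
      fix \<xi> \<eta> p assume \<xi>: "\<xi> \<in> ?X interior_of D\<^sub>0"
        and \<eta>: "\<eta> \<in> ?X interior_of (?X closure_of (boundary G S - D\<^sub>0))"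
        and p: "path_between G S \<rho> \<xi> \<eta> p"
      have "tends_to (\<lambda>n. p (- int n)) \<xi>" "tends_to (\<lambda>n. p (int n)) \<eta>"
        using p by (auto simp: path_between_def intro!: tends_to_limitin)
      then have "\<not> range (\<lambda>n. p (- int n)) \<subseteq> carrier G - D" "\<not> range (\<lambda>n. p (int n)) \<subseteq> D"
        using leave0[OF \<xi>] leave1 \<eta> by (auto simp: D1_def)
      then show "\<not> range p \<subseteq> D \<and> \<not> range p \<subseteq> carrier G - D" by blast
    qed (use D(2) in blast)
    then show ?thesis by blast
  qed
qed

end

theorem theorem5p2:
  fixes G :: "('a, 'm) monoid_scheme" and S :: "'a set"
    and \<rho> :: "'a + (nat \<Rightarrow> 'a) set \<Rightarrow> 'a + (nat \<Rightarrow> 'a) set \<Rightarrow> real"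
    and D\<^sub>0 :: "(nat \<Rightarrow> 'a) set set"
  assumes "group G"
    and "finite_symmetric_generating_set G S"
    and "word_hyperbolic G S"
    and "\<not> elementary_group G"
    and "visual_metric G S \<rho>"
    and "D\<^sub>0 \<subseteq> boundary G S"
    and "boundary_topology G S \<rho> closure_of (boundary_topology G S \<rho> interior_of D\<^sub>0) = D\<^sub>0"
  shows "\<exists>T. solves_asymptotic_plateau G S \<rho> D\<^sub>0 T"
proof -
  obtain \<delta> where \<delta>: "\<And>w x y z. \<lbrakk>w \<in> carrier G; x \<in> carrier G; y \<in> carrier G; z \<in> carrier G\<rbrakk> \<Longrightarrow>
      min (gromov_product G S w x y) (gromov_product G S w y z) - \<delta> \<le> gromov_product G S w x z"
    using assms(3) unfolding word_hyperbolic_def by blast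
  interpret group G by fact
  \<comment> \<open>The constant may be negative as given; enlarging it to
    \<open>max \<delta> 0\<close> keeps the inequality.\<close>
  interpret visual_hyperbolic_group G S "max \<delta> 0" \<rho>
  proof unfold_locales
    fix w x y z assume "w \<in> carrier G" "x \<in> carrier G" "y \<in> carrier G" "z \<in> carrier G"
    from \<delta>[OF this]
    show "min (gromov_product G S w x y) (gromov_product G S w y z) - max \<delta> 0 \<le> gromov_product G S w x z"
      by linarith
  qed (use assms in auto)
  show ?thesis using plateau_solution assms by blast
qed

end
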